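(* Let $p\ge 1$ be a real number and $n\ge 1$ an integer. A function $\Phi:L^p(\mathbb{C},\mathbb{R}^n)\to\mathbb{C}$ is a continuous translation invariant valuation if and only if there exist continuous functions $h_k:\mathbb{R}\to\mathbb{R}$ ($k=1,2,3,4$) with the property that there exist constants $\gamma_k\ge 0$ such that $|h_k(a)|\le\gamma_k|a|^p$ for all $a\in\mathbb{R}$ ($k=1,2,3,4$), and $$\Phi(f)=\int_{\mathbb{R}^n}(h_1\circ\Re f+h_3\circ\Im f)(x)\,dx+i\int_{\mathbb{R}^n}(h_2\circ\Re f+h_4\circ\Im f)(x)\,dx$$ for all $f\in L^p(\mathbb{C},\mathbb{R}^n)$.
   Context: $L^p(\mathbb{C},\mathbb{R}^n)$ is the $L^p$ space of Lebesgue measurable functions $f:\mathbb{R}^n\to\mathbb{C}$ with $\|f\|_p=(\int_{\mathbb{R}^n}|f|^p\,dx)^{1/p}<\infty$, where functions equal almost everywhere are identified. $\Re f$ and $\Im f$ are the real and imaginary parts of $f$. For complex-valued functions $f,g$, define $f\vee g=\max(\Re f,\Re g)+i\max(\Im f,\Im g)$ and $f\wedge g=\min(\Re f,\Re g)+i\min(\Im f,\Im g)$ (pointwise). A function $\Phi:L^p(\mathbb{C},\mathbb{R}^n)\to\mathbb{C}$ is a valuation if $\Phi(f\vee g)+\Phi(f\wedge g)=\Phi(f)+\Phi(g)$ for all $f,g$ in the space and $\Phi(0)=0$. It is continuous if $\Phi(f_i)\to\Phi(f)$ whenever $\|f_i-f\|_p\to 0$. It is translation invariant if $\Phi(f(\cdot-t))=\Phi(f)$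 for every $f$ in the space and every $t\in\mathbb{R}^n$. *)

theory Defs
  imports "HOL-Analysis.Analysis"
begin

text \<open>
  An element of \<open>L\<^sup>p(\<complex>, \<real>\<^sup>n)\<close> is an equivalence class of functions modulo equality almost everywhere,
  represented by the set of its members; a functional on the space takes such sets as arguments.
  Its values on sets that are not classes are irrelevant and never mentioned.
\<close>

definition lp_fun :: "real \<Rightarrow> (real ^ 'n \<Rightarrow> complex) set" where
  "lp_fun p = {f. f \<in> borel_measurable lebesgue \<and>
                  integrable lebesgue (\<lambda>x. cmod (f x) powr p)}"

definition lp_norm :: "real \<Rightarrow> (real ^ 'n \<Rightarrow> complex) \<Rightarrow> real" where
  "lp_norm p f = (LINT x|lebesgue. cmod (f x) powr p) powr (1 / p)"

definition lp_class :: "real \<Rightarrow> (real ^ 'n \<Rightarrow> complex) \<Rightarrow> (real ^ 'n \<Rightarrow> complex) set" where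
  "lp_class p f = {g \<in> lp_fun p. AE x in lebesgue. g x = f x}"

definition fun_join :: "('a \<Rightarrow> complex) \<Rightarrow> ('a \<Rightarrow> complex) \<Rightarrow> 'a \<Rightarrow> complex" where
  "fun_join f g = (\<lambda>x. Complex (max (Re (f x)) (Re (g x))) (max (Im (f x)) (Im (g x))))"

definition fun_meet :: "('a \<Rightarrow> complex) \<Rightarrow> ('a \<Rightarrow> complex) \<Rightarrow> 'a \<Rightarrow> complex" where
  "fun_meet f g = (\<lambda>x. Complex (min (Re (f x)) (Re (g x))) (min (Im (f x)) (Im (g x))))"

definition lp_valuation :: "real \<Rightarrow> ((real ^ 'n \<Rightarrow> complex) set \<Rightarrow> complex) \<Rightarrow> bool" where
  "lp_valuation p \<Phi> \<longleftrightarrow>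
     (\<forall>f \<in> lp_fun p. \<forall>g \<in> lp_fun p.
        \<Phi> (lp_class p (fun_join f g)) + \<Phi> (lp_class p (fun_meet f g))
          = \<Phi> (lp_class p f) + \<Phi> (lp_class p g)) \<and>
     \<Phi> (lp_class p (\<lambda>_. 0)) = 0"

definition lp_continuous :: "real \<Rightarrow> ((real ^ 'n \<Rightarrow> complex) set \<Rightarrow> complex) \<Rightarrow> bool" where
  "lp_continuous p \<Phi> \<longleftrightarrow>
     (\<forall>F f. (\<forall>i::nat. F i \<in> lp_fun p) \<and> f \<in> lp_fun p \<and>
            (\<lambda>i. lp_norm p (\<lambda>x. F i x - f x)) \<longlonglongrightarrow> 0 \<longrightarrow>
            (\<lambda>i. \<Phi> (lp_class p (F i))) \<longlonglongrightarrow> \<Phi> (lp_class p f))"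

definition lp_translation_invariant ::
    "real \<Rightarrow> ((real ^ 'n \<Rightarrow> complex) set \<Rightarrow> complex) \<Rightarrow> bool" where
  "lp_translation_invariant p \<Phi> \<longleftrightarrow>
     (\<forall>f \<in> lp_fun p. \<forall>t. \<Phi> (lp_class p (\<lambda>x. f (x - t))) = \<Phi> (lp_class p f))"

end

theory Submission
  imports Defs
begin

text \<open>
  For \<open>u\<close>, \<open>v\<close> the real and imaginary parts of \<open>f\<close>, the pair \<open>u\<close>, \<open>\<i> v\<close> has the same join and
  meet as the pair \<open>f\<close>, \<open>0\<close>; hence \<open>\<Phi> f = \<Phi> u + \<Phi> (\<i> v)\<close>, and the claim reduces to four real
  functionals on real-valued functions. Such a functional \<open>\<Psi>\<close> is additive on functions with disjoint
  supports, so \<open>A \<mapsto> \<Psi> (a * indicator A)\<close> is an additive, translation invariant and continuous set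
  function. Comparing it on the cubes of finer and finer grids shows that it equals \<open>h a\<close> times
  Lebesgue measure. Continuity at \<open>0\<close>, tested on \<open>a\<^sub>k * indicator A\<^sub>k\<close> with
  \<open>measure A\<^sub>k = 1 / ((k + 1) * \<bar>a\<^sub>k\<bar> powr p)\<close>, gives the growth bound on \<open>h\<close>. The integral formula
  then holds for simple functions, and for all functions by dominated convergence.
\<close>

section \<open>Translation invariant additive set functions\<close>

text \<open>For \<open>m > 0\<close> this is a half-open cube of side \<open>1 / m\<close>. As
  fibres of a single map, the cells of one grid are disjoint and cover the space, with no shared
  faces to treat separately.\<close>

definition grid_cell :: "nat \<Rightarrow> ('n \<Rightarrow> int) \<Rightarrow> (real ^ 'n) set" where
  "grid_cell m j = {x. (\<lambda>i. \<lfloor>real m * x $ i\<rfloor>) = j}"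

lemma grid_cell_lmeasurable:
  assumes "m > 0"
  shows "grid_cell m j \<in> lmeasurable"
proof (rule bounded_set_imp_lmeasurable)
  have le: "of_int (j i) / m \<le> x $ i" "x $ i \<le> (of_int (j i) + 1) / m" if "x \<in> grid_cell m j" for x i
  proof -
    have "\<lfloor>real m * x $ i\<rfloor> = j i"
      using that by (auto simp: grid_cell_def)
    then have "of_int (j i) \<le> real m * x $ i" "real m * x $ i \<le> of_int (j i) + 1"
      by linarith+
    then show "of_int (j i) / m \<le> x $ i" "x $ i \<le> (of_int (j i) + 1) / m"
      using assms by (auto simp: field_simps)
  qed
  have "grid_cell m j \<subseteq> cbox (\<chi> i. of_int (j i) / m) (\<chi> i. (of_int (j i) + 1) / m)"
    using le by (auto simp: mem_box_cart)
  then show "bounded (grid_cell m j)"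
    using bounded_cbox bounded_subset by blast
  have "grid_cell m j = (\<Inter>i. {x. \<lfloor>real m * x $ i\<rfloor> = j i})"
    by (auto simp: grid_cell_def)
  also have "\<dots> \<in> sets borel"
    by (intro sets.countable_INT') auto
  finally show "grid_cell m j \<in> sets lebesgue"
    by simp
qed

lemma mem_translation_iff:
  fixes x t :: "'a::ab_group_add"
  shows "x \<in> (+) t ` A \<longleftrightarrow> x - t \<in> A"
  by (auto intro!: image_eqI[of _ _ "x - t"])

lemma grid_cell_translation:
  fixes j :: "'n::finite \<Rightarrow> int"
  assumes "m > 0"
  shows "grid_cell m j = (+) (\<chi> i. of_int (j i) / m) ` grid_cell m (\<lambda>_. 0)"
proof -
  have *: "\<lfloor>real m * (x $ i - of_int (j i) / m)\<rfloor> = 0 \<longleftrightarrow> \<lfloor>real m * x $ i\<rfloor> = j i" for x :: "real ^ 'n" and i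
  proof -
    have "real m * (x $ i - of_int (j i) / m) = real m * x $ i - of_int (j i)"
      using assms by (simp add: field_simps)
    then show ?thesis by simp
  qed
  have "x \<in> grid_cell m j \<longleftrightarrow> x - (\<chi> i. of_int (j i) / m) \<in> grid_cell m (\<lambda>_. 0)" for x
    using * by (simp add: grid_cell_def fun_eq_iff)
  then show ?thesis
    by (simp add: set_eq_iff mem_translation_iff)
qed

text \<open>In each coordinate, \<open>y\<close> lies in [0, 1) iff \<open>m * y\<close> lies in [0,
  m). This division of the unit cell into translates of one small cell carries values from the unit
  grid to every finer grid.\<close>

lemma unit_grid_cell_eq:
  assumes "m > 0"
  shows "grid_cell 1 (\<lambda>_. 0) = (\<Union>j \<in> PiE UNIV (\<lambda>_. {0..<int m}). grid_cell m j)"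
proof -
  have "\<lfloor>y\<rfloor> = 0 \<longleftrightarrow> 0 \<le> \<lfloor>real m * y\<rfloor> \<and> \<lfloor>real m * y\<rfloor> < int m" for y :: real
  proof -
    have "0 \<le> real m * y \<longleftrightarrow> 0 \<le> y" "real m * y < real m \<longleftrightarrow> y < 1"
      using assms by (auto simp: zero_le_mult_iff)
    then show ?thesis
      by (simp add: floor_eq_iff floor_less_iff)
  qed
  then have "x \<in> grid_cell 1 (\<lambda>_. 0) \<longleftrightarrow>
      (\<lambda>i. \<lfloor>real m * x $ i\<rfloor>) \<in> PiE UNIV (\<lambda>_. {0..<int m})" for x :: "real ^ 'n"
    by (simp add: grid_cell_def fun_eq_iff PiE_iff del: zero_le_floor floor_less_iff)
  then show ?thesis
    by (auto simp: grid_cell_def)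
qed

text \<open>A bounded set meets only finitely many cells, so finite additivity suffices to evaluate
  the union of the cells that meet it.\<close>

lemma finite_grid_cells_of_bounded:
  fixes K :: "(real ^ 'n) set"
  assumes "bounded K"
  shows "finite ((\<lambda>x i. \<lfloor>real m * x $ i\<rfloor>) ` K)"
proof -
  obtain B where B: "\<And>x. x \<in> K \<Longrightarrow> norm x \<le> B"
    using assms by (auto simp: bounded_iff)
  have "\<lfloor>real m * x $ i\<rfloor> \<in> {\<lfloor>- (real m * B)\<rfloor>..\<lfloor>real m * B\<rfloor>}" if "x \<in> K" for x i
  proof -
    have "\<bar>x $ i\<bar> \<le> B"
      using B[OF that] component_le_norm_cart[of x i] by linarith
    then have "\<bar>real m * x $ i\<bar> \<le> real m * B"
      by (simp add: abs_mult mult_left_mono)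
    then show ?thesis
      by (auto intro!: floor_mono)
  qed
  then have "(\<lambda>x i. \<lfloor>real m * x $ i\<rfloor>) ` K \<subseteq> PiE UNIV (\<lambda>_. {\<lfloor>- (real m * B)\<rfloor>..\<lfloor>real m * B\<rfloor>})"
    by (auto simp: PiE_def)
  then show ?thesis
    by (rule finite_subset) (auto intro!: finite_PiE)
qed

text \<open>The Euclidean norm is at most the sum of the absolute coordinates. The resulting
  constant is not sharp; it matters only that the bound tends to 0 as the grid is refined.\<close>

lemma same_grid_cell_dist:
  fixes x y :: "real ^ 'n"
  assumes "m > 0" "x \<in> grid_cell m j" "y \<in> grid_cell m j"
  shows "dist x y \<le> CARD('n) / m"
proof -
  have "\<bar>(x - y) $ i\<bar> \<le> 1 / m" for i
  proof -
    have "\<lfloor>real m * x $ i\<rfloor> = \<lfloor>real m * y $ i\<rfloor>"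
      using assms by (auto simp: grid_cell_def fun_eq_iff)
    then have "\<bar>real m * x $ i - real m * y $ i\<bar> \<le> 1"
      by linarith
    then have "real m * \<bar>x $ i - y $ i\<bar> \<le> 1"
      by (metis abs_mult abs_of_nat right_diff_distrib)
    then show ?thesis
      using assms by (simp add: field_simps)
  qed
  then have "(\<Sum>i\<in>UNIV. \<bar>(x - y) $ i\<bar>) \<le> (\<Sum>i\<in>(UNIV :: 'n set). 1 / m)"
    by (intro sum_mono) auto
  then show ?thesis
    using norm_le_l1_cart[of "x - y"] by (simp add: dist_norm)
qed

text \<open>Dominated convergence with the indicator of \<open>B\<close> as the bound. It supplies
  the premise of the continuity hypothesis in the next lemma.\<close>

lemma tendsto_integral_indicator_diff:
  fixes A :: "nat \<Rightarrow> 'a::euclidean_space set"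
  assumes "\<And>i. A i \<in> sets lebesgue" "S \<in> sets lebesgue" "B \<in> lmeasurable" "\<And>i. A i \<subseteq> B" "S \<subseteq> B"
    and "\<And>x. \<forall>\<^sub>F i in sequentially. x \<in> A i \<longleftrightarrow> x \<in> S"
  shows "(\<lambda>i. LINT x|lebesgue. \<bar>indicat_real (A i) x - indicat_real S x\<bar>) \<longlonglongrightarrow> 0"
proof -
  have "(\<lambda>i. LINT x|lebesgue. \<bar>indicat_real (A i) x - indicat_real S x\<bar>) \<longlonglongrightarrow> (LINT x::'a|lebesgue. (0::real))"
  proof (rule integral_dominated_convergence[where w = "indicat_real B"])
    show "integrable lebesgue (indicat_real B)"
      using assms by (auto simp: fmeasurable_def)
    show "AE x in lebesgue. norm \<bar>indicat_real (A i) x - indicat_real S x\<bar> \<le> indicat_real B x" for i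
      using assms(4)[of i] assms(5) by (intro AE_I2) (auto simp: indicator_def)
    have "(\<lambda>i. \<bar>indicat_real (A i) x - indicat_real S x\<bar>) \<longlonglongrightarrow> 0" for x
      by (rule tendsto_eventually) (use assms(6)[of x] in eventually_elim, auto simp: indicator_def)
    then show "AE x in lebesgue. (\<lambda>i. \<bar>indicat_real (A i) x - indicat_real S x\<bar>) \<longlonglongrightarrow> 0"
      by simp
  qed (use assms in auto)
  then show ?thesis by simp
qed

text \<open>Vanishing spreads from the unit cell to all cells by subdivision, to compact sets by
  outer approximation with cells, to closed sets by cutting with balls, and to all sets of finite
  measure by inner regularity. Continuity stands in for countable additivity in the last three
  stages.\<close>

lemma translation_invariant_additive_vanishes:
  fixes \<nu> :: "(real ^ 'n) set \<Rightarrow> real"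
  assumes add: "\<And>A B. A \<in> lmeasurable \<Longrightarrow> B \<in> lmeasurable \<Longrightarrow> A \<inter> B = {} \<Longrightarrow> \<nu> (A \<union> B) = \<nu> A + \<nu> B"
    and trans: "\<And>A t. A \<in> lmeasurable \<Longrightarrow> \<nu> ((+) t ` A) = \<nu> A"
    and cont: "\<And>A S. (\<And>i. A i \<in> lmeasurable) \<Longrightarrow> S \<in> lmeasurable \<Longrightarrow>
        (\<lambda>i::nat. LINT x|lebesgue. \<bar>indicat_real (A i) x - indicat_real S x\<bar>) \<longlonglongrightarrow> 0 \<Longrightarrow>
        (\<lambda>i. \<nu> (A i)) \<longlonglongrightarrow> \<nu> S"
    and unit: "\<nu> (grid_cell 1 (\<lambda>_. 0)) = 0"
    and S: "S \<in> lmeasurable"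
  shows "\<nu> S = 0"
proof -
  have empty: "\<nu> {} = 0"
    using add[of "{}" "{}"] by simp
  have UN: "\<nu> (\<Union>j\<in>J. grid_cell m j) = (\<Sum>j\<in>J. \<nu> (grid_cell m j))" if "finite J" "m > 0" for J m
    using that(1)
  proof induction
    case (insert j J)
    have "(\<Union>j\<in>J. grid_cell m j) \<in> lmeasurable"
      using insert that by (intro fmeasurable.finite_UN) (auto simp: grid_cell_lmeasurable)
    moreover have "grid_cell m j \<inter> (\<Union>j\<in>J. grid_cell m j) = {}"
      using insert(2) by (auto simp: grid_cell_def)
    ultimately show ?case
      using insert that by (simp add: add grid_cell_lmeasurable)
  qed (simp add: empty)
  have cell_eq: "\<nu> (grid_cell m j) = \<nu> (grid_cell m (\<lambda>_. 0))" if "m > 0" for m j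
    using grid_cell_translation[OF that, of j] trans grid_cell_lmeasurable[OF that] by metis
  \<comment> \<open>The cells that make up the unit cell have one common value by translation
    invariance, and these values sum to 0.\<close>
  have cell: "\<nu> (grid_cell m j) = 0" if "m > 0" for m j
  proof -
    let ?J = "PiE (UNIV :: 'n set) (\<lambda>_. {0..<int m})"
    have "finite ?J" "?J \<noteq> {}"
      using that by (auto intro!: finite_PiE simp: PiE_eq_empty_iff)
    have "0 = \<nu> (\<Union>j\<in>?J. grid_cell m j)"
      using unit_grid_cell_eq[OF that] unit by metis
    also have "\<dots> = (\<Sum>j\<in>?J. \<nu> (grid_cell m j))"
      by (rule UN) fact+
    also have "\<dots> = (\<Sum>j\<in>?J. \<nu> (grid_cell m (\<lambda>_. 0)))"
      using cell_eq[OF that] by (intro sum.cong) auto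
    also have "\<dots> = card ?J * \<nu> (grid_cell m (\<lambda>_. 0))"
      by simp
    finally show ?thesis
      using \<open>finite ?J\<close> \<open>?J \<noteq> {}\<close> cell_eq[OF that] by (metis card_eq_0_iff mult_eq_0_iff of_nat_eq_0_iff)
  qed
  have compact: "\<nu> K = 0" if "compact K" for K
  proof -
    \<comment> \<open>\<open>J m\<close> indexes the cells that meet \<open>K\<close>, and
      \<open>U k\<close> is their union for the grid of mesh \<open>1 / Suc k\<close>; the successor
      avoids the degenerate grid \<open>m = 0\<close>.\<close>
    define J where "J m = (\<lambda>x i. \<lfloor>real m * x $ i\<rfloor>) ` K" for m
    define U where "U k = (\<Union>j\<in>J (Suc k). grid_cell (Suc k) j)" for k
    have fin: "finite (J m)" for m
      unfolding J_def using that by (intro finite_grid_cells_of_bounded compact_imp_bounded)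
    have U: "U k \<in> lmeasurable" for k
      unfolding U_def using fin by (intro fmeasurable.finite_UN) (auto simp: grid_cell_lmeasurable)
    have near: "\<exists>y\<in>K. dist x y \<le> CARD('n) / Suc k" if "x \<in> U k" for x k
    proof -
      obtain y where "y \<in> K" "x \<in> grid_cell (Suc k) (\<lambda>i. \<lfloor>real (Suc k) * y $ i\<rfloor>)"
        using \<open>x \<in> U k\<close> by (auto simp: U_def J_def)
      then show ?thesis
        by (intro bexI[of _ y] same_grid_cell_dist) (auto simp: grid_cell_def)
    qed
    have sub: "K \<subseteq> U k" for k
      by (auto simp: U_def J_def grid_cell_def)
    obtain B where B: "\<And>x. x \<in> K \<Longrightarrow> norm x \<le> B"
      using compact_imp_bounded[OF \<open>compact K\<close>] by (auto simp: bounded_iff)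
    \<comment> \<open>Dominated convergence needs one set of finite measure that contains every
      \<open>U k\<close>; the coarsest mesh gives the radius.\<close>
    have bd: "U k \<subseteq> cball 0 (B + CARD('n))" for k
    proof
      fix x assume "x \<in> U k"
      then obtain y where y: "y \<in> K" "dist x y \<le> CARD('n) / Suc k"
        using near by blast
      have "real CARD('n) / Suc k \<le> CARD('n)"
        by (simp add: field_simps)
      moreover have "norm x \<le> norm y + dist x y"
        by (metis dist_norm norm_triangle_sub)
      ultimately show "x \<in> cball 0 (B + CARD('n))"
        using y B[of y] by simp
    qed
    have "(\<lambda>k. \<nu> (U k)) \<longlonglongrightarrow> \<nu> K"
    proof (rule cont[OF U])
      show "K \<in> lmeasurable"
        using that by (rule lmeasurable_compact)
      show "(\<lambda>k. LINT x|lebesgue. \<bar>indicat_real (U k) x - indicat_real K x\<bar>) \<longlonglongrightarrow> 0"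
      proof (rule tendsto_integral_indicator_diff[where B = "cball 0 (B + CARD('n))"])
        show "K \<subseteq> cball 0 (B + CARD('n))"
          using sub[of 0] bd[of 0] by blast
        fix x
        show "\<forall>\<^sub>F k in sequentially. x \<in> U k \<longleftrightarrow> x \<in> K"
        proof (cases "x \<in> K")
          \<comment> \<open>A point outside the compact set \<open>K\<close> has a positive distance
            \<open>e\<close> from it, hence leaves \<open>U k\<close> once the diameter bound of the
            cells drops below \<open>e\<close>.\<close>
          case False
          then obtain e where e: "e > 0" "\<And>y. y \<in> K \<Longrightarrow> e \<le> dist x y"
            using separate_point_closed[OF compact_imp_closed[OF \<open>compact K\<close>]] by blast
          have "(\<lambda>k. real CARD('n) / Suc k) \<longlonglongrightarrow> 0"
            by (rule LIMSEQ_Suc) (rule lim_const_over_n)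
          then have "\<forall>\<^sub>F k in sequentially. real CARD('n) / Suc k < e"
            using e(1) order_tendstoD(2) by blast
          then show ?thesis
            by eventually_elim (use near e(2) False in fastforce)
        next
          case True
          then have "x \<in> U k" for k
            using sub by blast
          then show ?thesis
            using True by simp
        qed
      qed (use U bd lmeasurable_compact[OF that] in \<open>auto simp: fmeasurableD\<close>)
    qed
    moreover have "\<nu> (U k) = 0" for k
      unfolding U_def by (subst UN) (auto simp: fin cell)
    ultimately show ?thesis
      using LIMSEQ_unique[of "\<lambda>_. 0" 0 "\<nu> K"] by simp
  qed
  have closed: "\<nu> C = 0" if "closed C" "C \<in> lmeasurable" for C
  proof -
    have "(\<lambda>k. \<nu> (C \<inter> cball 0 (real k))) \<longlonglongrightarrow> \<nu> C"
    proof (rule cont)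
      show "(\<lambda>k. LINT x|lebesgue. \<bar>indicat_real (C \<inter> cball 0 (real k)) x - indicat_real C x\<bar>) \<longlonglongrightarrow> 0"
      proof (rule tendsto_integral_indicator_diff[where B = C])
        show "\<forall>\<^sub>F k in sequentially. x \<in> C \<inter> cball 0 (real k) \<longleftrightarrow> x \<in> C" for x
          using eventually_ge_at_top[of "nat \<lceil>norm x\<rceil>"] by eventually_elim auto
      qed (use that in \<open>auto simp: fmeasurableD\<close>)
    qed (use that in \<open>auto intro!: fmeasurable.Int\<close>)
    moreover have "\<nu> (C \<inter> cball 0 (real k)) = 0" for k
      using that by (intro compact) (simp add: closed_Int_compact)
    ultimately show ?thesis
      using LIMSEQ_unique[of "\<lambda>_. 0" 0 "\<nu> C"] by simp
  qed
  have "\<exists>T. closed T \<and> T \<in> lmeasurable \<and> T \<subseteq> S \<and> measure lebesgue (S - T) < 1 / Suc k" for k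
  proof -
    obtain T where "closed T" "T \<subseteq> S" "S - T \<in> lmeasurable" "emeasure lebesgue (S - T) < ennreal (1 / Suc k)"
      using sets_lebesgue_inner_closed[of S "1 / Suc k"] S by (auto simp: fmeasurableD)
    moreover from this have "measure lebesgue (S - T) < 1 / Suc k"
      by (simp add: emeasure_eq_measure2 ennreal_less_iff)
    moreover have "T \<in> lmeasurable"
      using \<open>closed T\<close> \<open>T \<subseteq> S\<close> S by (auto intro: fmeasurableI2)
    ultimately show ?thesis by blast
  qed
  then obtain T where T: "\<And>k. closed (T k)" "\<And>k. T k \<in> lmeasurable" "\<And>k. T k \<subseteq> S"
      "\<And>k. measure lebesgue (S - T k) < 1 / Suc k"
    by metis
  have "(\<lambda>k. \<nu> (T k)) \<longlonglongrightarrow> \<nu> S"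
  proof (rule cont[OF T(2) S])
    \<comment> \<open>Because \<open>T k\<close> lies inside \<open>S\<close>, the distance of the
      indicators is just the measure of the part that was left out.\<close>
    have "(\<lambda>x. \<bar>indicat_real (T k) x - indicat_real S x\<bar>) = indicat_real (S - T k)" for k
      using T(3)[of k] by (auto simp: fun_eq_iff indicator_def)
    then have eq: "(LINT x|lebesgue. \<bar>indicat_real (T k) x - indicat_real S x\<bar>) = measure lebesgue (S - T k)" for k
      by simp
    have "(\<lambda>k. measure lebesgue (S - T k)) \<longlonglongrightarrow> 0"
      by (rule tendsto_sandwich[OF _ _ tendsto_const LIMSEQ_Suc[OF lim_const_over_n[of 1]]])
        (use T(4) in \<open>auto intro!: always_eventually less_imp_le\<close>)
    then show "(\<lambda>k. LINT x|lebesgue. \<bar>indicat_real (T k) x - indicat_real S x\<bar>) \<longlonglongrightarrow> 0"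
      by (simp add: eq)
  qed
  then show ?thesis
    using LIMSEQ_unique[of "\<lambda>_. 0" 0 "\<nu> S"] closed T by simp
qed

text \<open>The open unit cube sits inside the cell. Positivity permits normalising by this measure
  in the next lemma.\<close>

lemma measure_unit_grid_cell_pos: "0 < measure lebesgue (grid_cell 1 (\<lambda>_. 0) :: (real ^ 'n) set)"
proof -
  have "box 0 1 \<subseteq> (grid_cell 1 (\<lambda>_. 0) :: (real ^ 'n) set)"
    by (auto simp: grid_cell_def mem_box_cart floor_eq_iff fun_eq_iff intro: less_imp_le)
  then have "measure lebesgue (box 0 1 :: (real ^ 'n) set) \<le> measure lebesgue (grid_cell 1 (\<lambda>_. 0) :: (real ^ 'n) set)"
    by (intro measure_mono_fmeasurable) (auto simp: grid_cell_lmeasurable fmeasurableD)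
  moreover have "measure lebesgue (box 0 1 :: (real ^ 'n) set) = 1"
    using content_cbox_cart[of 0 "1 :: real ^ 'n"] by (simp add: measure_lborel_box_eq measure_lborel_cbox_eq mem_box_cart interval_eq_empty_cart)
  ultimately show ?thesis by linarith
qed

text \<open>Subtract from \<open>\<nu>\<close> the multiple of Lebesgue measure that agrees with it
  on the unit cell; the difference satisfies all hypotheses of the vanishing lemma.\<close>

lemma translation_invariant_additive_eq_measure:
  fixes \<nu> :: "(real ^ 'n) set \<Rightarrow> real"
  assumes add: "\<And>A B. A \<in> lmeasurable \<Longrightarrow> B \<in> lmeasurable \<Longrightarrow> A \<inter> B = {} \<Longrightarrow> \<nu> (A \<union> B) = \<nu> A + \<nu> B"
    and trans: "\<And>A t. A \<in> lmeasurable \<Longrightarrow> \<nu> ((+) t ` A) = \<nu> A"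
    and cont: "\<And>A S. (\<And>i. A i \<in> lmeasurable) \<Longrightarrow> S \<in> lmeasurable \<Longrightarrow>
        (\<lambda>i::nat. LINT x|lebesgue. \<bar>indicat_real (A i) x - indicat_real S x\<bar>) \<longlonglongrightarrow> 0 \<Longrightarrow>
        (\<lambda>i. \<nu> (A i)) \<longlonglongrightarrow> \<nu> S"
  obtains c where "\<And>S. S \<in> lmeasurable \<Longrightarrow> \<nu> S = c * measure lebesgue S"
proof -
  let ?Q = "grid_cell 1 (\<lambda>_. 0) :: (real ^ 'n) set"
  define c where "c = \<nu> ?Q / measure lebesgue ?Q"
  have "\<nu> S - c * measure lebesgue S = 0" if "S \<in> lmeasurable" for S
  proof (rule translation_invariant_additive_vanishes[where \<nu> = "\<lambda>S. \<nu> S - c * measure lebesgue S"])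
    fix A B :: "(real ^ 'n) set"
    assume "A \<in> lmeasurable" "B \<in> lmeasurable" "A \<inter> B = {}"
    then show "\<nu> (A \<union> B) - c * measure lebesgue (A \<union> B)
        = \<nu> A - c * measure lebesgue A + (\<nu> B - c * measure lebesgue B)"
      by (simp add: add measure_Un3 algebra_simps)
  next
    fix A :: "nat \<Rightarrow> (real ^ 'n) set" and S
    assume A: "\<And>i. A i \<in> lmeasurable" and S: "S \<in> lmeasurable"
      and lim: "(\<lambda>i. LINT x|lebesgue. \<bar>indicat_real (A i) x - indicat_real S x\<bar>) \<longlonglongrightarrow> 0"
    have int: "integrable lebesgue (indicat_real X)" if "X \<in> lmeasurable" for X :: "(real ^ 'n) set"
      using that by (auto simp: fmeasurable_def)
    \<comment> \<open>Lebesgue measure is itself continuous in the required sense: a difference of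
      measures is the integral of a difference of indicators.\<close>
    have "(\<lambda>i. measure lebesgue (A i) - measure lebesgue S) \<longlonglongrightarrow> 0"
    proof (rule Lim_null_comparison[OF _ lim], rule always_eventually, rule allI)
      fix i
      have "measure lebesgue (A i) - measure lebesgue S = (LINT x|lebesgue. indicat_real (A i) x - indicat_real S x)"
        by (subst Bochner_Integration.integral_diff) (use int A S in auto)
      then show "norm (measure lebesgue (A i) - measure lebesgue S)
          \<le> (LINT x|lebesgue. \<bar>indicat_real (A i) x - indicat_real S x\<bar>)"
        by (metis integral_abs_bound real_norm_def)
    qed
    then have "(\<lambda>i. measure lebesgue (A i)) \<longlonglongrightarrow> measure lebesgue S"
      by (simp add: LIM_zero_iff)
    then show "(\<lambda>i. \<nu> (A i) - c * measure lebesgue (A i)) \<longlonglongrightarrow> \<nu> S - c * measure lebesgue S"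
      using cont[OF A S lim] by (intro tendsto_intros)
  next
    show "\<nu> ?Q - c * measure lebesgue ?Q = 0"
      using measure_unit_grid_cell_pos[where 'n = 'n] by (simp add: c_def)
  qed (use that trans in \<open>auto simp: measure_translation\<close>)
  then show ?thesis
    using that[of c] by simp
qed

section \<open>The spaces of p-integrable functions\<close>

text \<open>The codomain is left general so that complex functions and their real and imaginary
  parts are covered by the same lemmas.\<close>

definition lp_space :: "real \<Rightarrow> ('a::euclidean_space \<Rightarrow> 'b::{banach, second_countable_topology}) set" where
  "lp_space p = {f. f \<in> borel_measurable lebesgue \<and> integrable lebesgue (\<lambda>x. norm (f x) powr p)}"

lemma lp_spaceD:
  assumes "f \<in> lp_space p"
  shows "f \<in> borel_measurable lebesgue" "integrable lebesgue (\<lambda>x. norm (f x) powr p)"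
  using assms by (auto simp: lp_space_def)

lemma lp_space_dominated:
  assumes "p > 0" "f \<in> borel_measurable lebesgue" "g \<in> lp_space p" "C \<ge> 0"
    and "\<And>x. norm (f x) \<le> C * norm (g x)"
  shows "f \<in> lp_space p"
proof -
  have "integrable lebesgue (\<lambda>x. norm (f x) powr p)"
  proof (rule Bochner_Integration.integrable_bound)
    show "integrable lebesgue (\<lambda>x. C powr p * norm (g x) powr p)"
      using assms(3) by (auto simp: lp_space_def)
    have "norm (f x) powr p \<le> C powr p * norm (g x) powr p" for x
      using assms powr_mono2[of p "norm (f x)" "C * norm (g x)"] by (simp add: powr_mult)
    then show "AE x in lebesgue. norm (norm (f x) powr p) \<le> norm (C powr p * norm (g x) powr p)"
      by simp
  qed (use assms in simp)
  then show ?thesis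
    using assms by (simp add: lp_space_def)
qed

text \<open>Bounding the sum by twice the maximum avoids convexity, so the estimate holds for every
  \<open>p > 0\<close>. It gives closure under addition and, later, the dominating
  functions.\<close>

lemma norm_add_powr_le:
  fixes a b :: "'b::real_normed_vector"
  assumes "p > 0"
  shows "norm (a + b) powr p \<le> 2 powr p * (norm a powr p + norm b powr p)"
proof -
  have "norm (a + b) \<le> 2 * max (norm a) (norm b)"
    using norm_triangle_ineq[of a b] by linarith
  then have "norm (a + b) powr p \<le> (2 * max (norm a) (norm b)) powr p"
    using assms by (intro powr_mono2) auto
  also have "\<dots> = 2 powr p * max (norm a) (norm b) powr p"
    by (rule powr_mult)
  also have "\<dots> \<le> 2 powr p * (norm a powr p + norm b powr p)"
    by (intro mult_left_mono) (auto simp: max_def)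
  finally show ?thesis .
qed

lemma lp_space_add:
  assumes "p > 0" "f \<in> lp_space p" "g \<in> lp_space p"
  shows "(\<lambda>x. f x + g x) \<in> lp_space p"
proof -
  note [measurable] = lp_spaceD(1)[OF assms(2)] lp_spaceD(1)[OF assms(3)]
  have "integrable lebesgue (\<lambda>x. norm (f x + g x) powr p)"
  proof (rule Bochner_Integration.integrable_bound)
    show "integrable lebesgue (\<lambda>x. 2 powr p * (norm (f x) powr p + norm (g x) powr p))"
      using assms by (auto simp: lp_space_def)
    show "AE x in lebesgue. norm (norm (f x + g x) powr p)
        \<le> norm (2 powr p * (norm (f x) powr p + norm (g x) powr p))"
      by (rule AE_I2) (simp add: norm_add_powr_le[OF assms(1)])
  qed measurable
  then show ?thesis
    by (simp add: lp_space_def)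
qed

lemma lp_space_diff:
  assumes "p > 0" "f \<in> lp_space p" "g \<in> lp_space p"
  shows "(\<lambda>x. f x - g x) \<in> lp_space p"
proof -
  have "(\<lambda>x. - g x) \<in> lp_space p"
    using assms by (auto simp: lp_space_def)
  then show ?thesis
    using lp_space_add[OF assms(1,2), of "\<lambda>x. - g x"] by simp
qed

lemma lp_space_zero [simp]: "(\<lambda>_. 0) \<in> lp_space p"
  by (simp add: lp_space_def)

text \<open>Both functions are dominated by the sum of the absolute values.\<close>

lemma lp_space_max_min:
  fixes u v :: "'a::euclidean_space \<Rightarrow> real"
  assumes "p > 0" "u \<in> lp_space p" "v \<in> lp_space p"
  shows "(\<lambda>x. max (u x) (v x)) \<in> lp_space p" "(\<lambda>x. min (u x) (v x)) \<in> lp_space p"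
proof -
  note [measurable] = lp_spaceD(1)[OF assms(2)] lp_spaceD(1)[OF assms(3)]
  have "(\<lambda>x. \<bar>u x\<bar>) \<in> lp_space p" "(\<lambda>x. \<bar>v x\<bar>) \<in> lp_space p"
    using assms by (auto simp: lp_space_def)
  then have "(\<lambda>x. \<bar>u x\<bar> + \<bar>v x\<bar>) \<in> lp_space p"
    by (rule lp_space_add[OF assms(1)])
  moreover have "\<bar>max a b\<bar> \<le> \<bar>a\<bar> + \<bar>b\<bar>" "\<bar>min a b\<bar> \<le> \<bar>a\<bar> + \<bar>b\<bar>" for a b :: real
    by linarith+
  ultimately show "(\<lambda>x. max (u x) (v x)) \<in> lp_space p" "(\<lambda>x. min (u x) (v x)) \<in> lp_space p"
    by (auto intro!: lp_space_dominated[where g = "\<lambda>x. \<bar>u x\<bar> + \<bar>v x\<bar>" and C = 1] assms(1))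
qed

lemma lp_space_indicator:
  fixes a :: real
  assumes "A \<in> lmeasurable"
  shows "(\<lambda>x. a * indicat_real A x) \<in> lp_space p"
    and "(LINT x|lebesgue. \<bar>a * indicat_real A x\<bar> powr p) = \<bar>a\<bar> powr p * measure lebesgue A"
proof -
  have eq: "\<bar>a * indicat_real A x\<bar> powr p = \<bar>a\<bar> powr p * indicat_real A x" for x
    by (auto simp: indicator_def)
  have "integrable lebesgue (\<lambda>x. \<bar>a * indicat_real A x\<bar> powr p)"
    unfolding eq using assms by (auto simp: fmeasurable_def)
  then show "(\<lambda>x. a * indicat_real A x) \<in> lp_space p"
    using assms by (simp add: lp_space_def fmeasurableD)
  show "(LINT x|lebesgue. \<bar>a * indicat_real A x\<bar> powr p) = \<bar>a\<bar> powr p * measure lebesgue A"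
    unfolding eq by simp
qed

text \<open>A translation is the affine map with all scaling factors 1, so the density in the affine
  change of variables is the constant 1.\<close>

lemma lebesgue_distr_translation:
  fixes t :: "'a::euclidean_space"
  shows "distr lebesgue lebesgue (\<lambda>x. x - t) = lebesgue"
    and "(\<lambda>x. x - t) \<in> lebesgue \<rightarrow>\<^sub>M lebesgue"
proof -
  have *: "(\<lambda>x. - t + (\<Sum>j\<in>Basis. (1 * (x \<bullet> j)) *\<^sub>R j)) = (\<lambda>x. x - t)"
    by (simp add: euclidean_representation)
  show "distr lebesgue lebesgue (\<lambda>x. x - t) = lebesgue"
    using lebesgue_affine_euclidean[of "\<lambda>_. 1" "- t"] unfolding * by (simp add: density_1)
  show "(\<lambda>x. x - t) \<in> lebesgue \<rightarrow>\<^sub>M lebesgue"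
    using lebesgue_affine_measurable[of "\<lambda>_. 1" "- t"] unfolding * by simp
qed

lemma lebesgue_integral_translation:
  fixes f :: "'a::euclidean_space \<Rightarrow> 'b::{banach, second_countable_topology}"
  assumes "f \<in> borel_measurable lebesgue"
  shows "(LINT x|lebesgue. f (x - t)) = (LINT x|lebesgue. f x)"
  using integral_distr[OF lebesgue_distr_translation(2) assms, of t]
  by (simp add: lebesgue_distr_translation(1))

lemma lp_space_translation:
  assumes "f \<in> lp_space p"
  shows "(\<lambda>x. f (x - t)) \<in> lp_space p"
proof -
  note [measurable] = lp_spaceD(1)[OF assms] lebesgue_distr_translation(2)[of t]
  have "integrable (distr lebesgue lebesgue (\<lambda>x. x - t)) (\<lambda>x. norm (f x) powr p)"
    using lp_spaceD[OF assms] by (simp add: lebesgue_distr_translation(1))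
  then have "integrable lebesgue (\<lambda>x. norm (f (x - t)) powr p)"
    by (subst (asm) integrable_distr_eq) measurable
  then show ?thesis
    by (simp add: lp_space_def)
qed

section \<open>Integral functionals with an integrand of growth \<open>p\<close>, and their
  continuity\<close>

lemma integrable_powr_growth:
  fixes h :: "real \<Rightarrow> real"
  assumes "continuous_on UNIV h" "\<And>a. \<bar>h a\<bar> \<le> \<gamma> * \<bar>a\<bar> powr p" "u \<in> lp_space p"
  shows "integrable lebesgue (\<lambda>x. h (u x))"
proof (rule Bochner_Integration.integrable_bound)
  show "integrable lebesgue (\<lambda>x. \<gamma> * \<bar>u x\<bar> powr p)"
    using assms(3) by (auto simp: lp_space_def)
  show "(\<lambda>x. h (u x)) \<in> borel_measurable lebesgue"
    using lp_spaceD(1)[OF assms(3)] borel_measurable_continuous_onI[OF assms(1)]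
    by (rule measurable_compose)
  show "AE x in lebesgue. norm (h (u x)) \<le> norm (\<gamma> * \<bar>u x\<bar> powr p)"
    using assms(2) by (intro AE_I2) (auto intro: order_trans[OF _ abs_ge_self])
qed

text \<open>
  Along an almost everywhere convergent subsequence, \<open>\<bar>h (F i) - h f\<bar>\<close> is not dominated by one
  integrable function, but its excess over the \<open>L\<^sup>1\<close>-null sequence \<open>C * \<bar>F i - f\<bar> powr p\<close> is.
\<close>
lemma tendsto_integral_powr_growth_subseq:
  fixes h :: "real \<Rightarrow> real" and f :: "'a::euclidean_space \<Rightarrow> real"
  assumes p: "p > 0"
    and h: "continuous_on UNIV h" "\<And>a. \<bar>h a\<bar> \<le> \<gamma> * \<bar>a\<bar> powr p" "\<gamma> \<ge> 0"
    and F: "\<And>i. F i \<in> lp_space p" and f: "f \<in> lp_space p"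
    and lim: "(\<lambda>i. LINT x|lebesgue. \<bar>F i x - f x\<bar> powr p) \<longlonglongrightarrow> 0"
  obtains r :: "nat \<Rightarrow> nat" where "strict_mono r"
    "(\<lambda>i. LINT x|lebesgue. h (F (r i) x)) \<longlonglongrightarrow> (LINT x|lebesgue. h (f x))"
proof -
  note [measurable] = lp_spaceD(1)[OF F] lp_spaceD(1)[OF f] borel_measurable_continuous_onI[OF h(1)]
  \<comment> \<open>Writing \<open>F i\<close> as \<open>(F i - f) + f\<close>, the growth bound and
    \<open>norm_add_powr_le\<close> give \<open>\<bar>h (F i) - h f\<bar> \<le> g i + G\<close>. The
    summand \<open>\<gamma>\<close> in \<open>G\<close> accounts for \<open>h f\<close>
    itself.\<close>
  define C where "C = \<gamma> * 2 powr p"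
  define G where "G x = (C + \<gamma>) * \<bar>f x\<bar> powr p" for x
  define g where "g i x = C * \<bar>F i x - f x\<bar> powr p" for i x
  have C: "C \<ge> 0"
    using h(3) by (simp add: C_def)
  have int_diff: "integrable lebesgue (\<lambda>x. \<bar>F i x - f x\<bar> powr p)" for i
    using lp_spaceD(2)[OF lp_space_diff[OF p F f]] by simp
  have int_g: "integrable lebesgue (g i)" for i
    unfolding g_def using int_diff by simp
  have int_G: "integrable lebesgue G"
    unfolding G_def using lp_spaceD(2)[OF f] by simp
  have int_hF: "integrable lebesgue (\<lambda>x. h (F i x))" for i
    using integrable_powr_growth[OF h(1,2) F] .
  have int_hf: "integrable lebesgue (\<lambda>x. h (f x))"
    using integrable_powr_growth[OF h(1,2) f] .
  obtain r where r: "strict_mono r" "AE x in lebesgue. (\<lambda>i. \<bar>F (r i) x - f x\<bar> powr p) \<longlonglongrightarrow> 0"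
    using tendsto_L1_AE_subseq[of lebesgue "\<lambda>i x. \<bar>F i x - f x\<bar> powr p", OF int_diff] lim by auto
  have pt: "(\<lambda>i. F (r i) x) \<longlonglongrightarrow> f x" if "(\<lambda>i. \<bar>F (r i) x - f x\<bar> powr p) \<longlonglongrightarrow> 0" for x
  proof -
    \<comment> \<open>Taking the \<open>p\<close>-th root turns convergence of the powers into
      convergence of the values.\<close>
    have "(\<lambda>i. (\<bar>F (r i) x - f x\<bar> powr p) powr (1 / p)) \<longlonglongrightarrow> 0 powr (1 / p)"
      using that p by (intro tendsto_powr2) auto
    then have "(\<lambda>i. \<bar>F (r i) x - f x\<bar>) \<longlonglongrightarrow> 0"
      using p by (simp add: powr_powr)
    then show ?thesis
      by (simp add: LIM_zero_iff tendsto_rabs_zero_iff)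
  qed
  have bound: "\<bar>h (F i x) - h (f x)\<bar> \<le> g i x + G x" for i x
  proof -
    have "\<bar>h (F i x)\<bar> \<le> \<gamma> * \<bar>(F i x - f x) + f x\<bar> powr p"
      using h(2) by simp
    also have "\<dots> \<le> \<gamma> * (2 powr p * (\<bar>F i x - f x\<bar> powr p + \<bar>f x\<bar> powr p))"
      using norm_add_powr_le[OF p, of "F i x - f x" "f x"] h(3) by (intro mult_left_mono) auto
    finally show ?thesis
      using h(2)[of "f x"] by (simp add: g_def G_def C_def algebra_simps)
  qed
  \<comment> \<open>The excess, cut off at 0: it stays between 0 and \<open>G\<close>, tends to 0
    almost everywhere, and \<open>w i + g (r i)\<close> still bounds the difference of the
    integrands.\<close>
  define w where "w i x = max 0 (\<bar>h (F (r i) x) - h (f x)\<bar> - g (r i) x)" for i x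
  have [measurable]: "w i \<in> borel_measurable lebesgue" for i
    unfolding w_def g_def by measurable
  have g_nonneg: "g i x \<ge> 0" for i x
    using C by (simp add: g_def)
  have w_le: "\<bar>w i x\<bar> \<le> G x" for i x
    using bound[of "r i" x] g_nonneg[of "r i" x] h(3) C by (auto simp: w_def G_def)
  have "(\<lambda>i. LINT x|lebesgue. w i x) \<longlonglongrightarrow> (LINT x::'a|lebesgue. (0::real))"
  proof (rule integral_dominated_convergence[where w = G])
    show "AE x in lebesgue. (\<lambda>i. w i x) \<longlonglongrightarrow> 0"
      using r(2)
    proof eventually_elim
      case (elim x)
      have "isCont h (f x)"
        using h(1) continuous_on_eq_continuous_at open_UNIV by blast
      then have "(\<lambda>i. h (F (r i) x)) \<longlonglongrightarrow> h (f x)"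
        using pt[OF elim] by (rule isCont_tendsto_compose)
      then have "(\<lambda>i. \<bar>h (F (r i) x) - h (f x)\<bar>) \<longlonglongrightarrow> 0"
        by (simp add: LIM_zero tendsto_rabs_zero)
      then show "(\<lambda>i. w i x) \<longlonglongrightarrow> 0"
        by (rule Lim_null_comparison[rotated])
          (use g_nonneg in \<open>auto simp: w_def max_def intro!: always_eventually\<close>)
    qed
    show "AE x in lebesgue. norm (w i x) \<le> G x" for i
      using w_le by simp
  qed (use int_G in auto)
  moreover have "(\<lambda>i. LINT x|lebesgue. g (r i) x) \<longlonglongrightarrow> 0"
    unfolding g_def using tendsto_mult_right_zero[OF LIMSEQ_subseq_LIMSEQ[OF lim r(1)], of C]
    by (simp add: o_def)
  ultimately have sum0: "(\<lambda>i. (LINT x|lebesgue. w i x) + (LINT x|lebesgue. g (r i) x)) \<longlonglongrightarrow> 0"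
    using tendsto_add_zero by fastforce
  have "(\<lambda>i. (LINT x|lebesgue. h (F (r i) x)) - (LINT x|lebesgue. h (f x))) \<longlonglongrightarrow> 0"
  proof (rule Lim_null_comparison[OF _ sum0], rule always_eventually, rule allI)
    fix i
    have int_w: "integrable lebesgue (w i)"
      by (rule Bochner_Integration.integrable_bound[OF int_G]) (use w_le in \<open>auto intro!: AE_I2 intro: order_trans[OF _ abs_ge_self]\<close>)
    have "norm ((LINT x|lebesgue. h (F (r i) x)) - (LINT x|lebesgue. h (f x)))
        = \<bar>LINT x|lebesgue. h (F (r i) x) - h (f x)\<bar>"
      using int_hF int_hf by simp
    also have "\<dots> \<le> (LINT x|lebesgue. \<bar>h (F (r i) x) - h (f x)\<bar>)"
      by (rule integral_abs_bound)
    also have "\<dots> \<le> (LINT x|lebesgue. w i x + g (r i) x)"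
      by (rule integral_mono) (use int_hF int_hf int_w int_g in \<open>auto simp: w_def\<close>)
    also have "\<dots> = (LINT x|lebesgue. w i x) + (LINT x|lebesgue. g (r i) x)"
      using int_w int_g by simp
    finally show "norm ((LINT x|lebesgue. h (F (r i) x)) - (LINT x|lebesgue. h (f x)))
        \<le> (LINT x|lebesgue. w i x) + (LINT x|lebesgue. g (r i) x)" .
  qed
  then show ?thesis
    using that r(1) by (simp add: LIM_zero_iff)
qed

text \<open>If \<open>X\<close> did not tend to \<open>L\<close>, infinitely many terms would stay
  at distance at least \<open>e\<close>. These form a subsequence none of whose subsequences tends
  to \<open>L\<close>.\<close>

lemma tendsto_of_subseq:
  fixes X :: "nat \<Rightarrow> 'a::metric_space"
  assumes "\<And>s :: nat \<Rightarrow> nat. strict_mono s \<Longrightarrow> \<exists>r :: nat \<Rightarrow> nat. strict_mono r \<and> (\<lambda>i. X (s (r i))) \<longlonglongrightarrow> L"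
  shows "X \<longlonglongrightarrow> L"
proof (rule ccontr)
  assume "\<not> X \<longlonglongrightarrow> L"
  then obtain e where e: "e > 0" "\<forall>N. \<exists>n\<ge>N. dist (X n) L \<ge> e"
    by (auto simp: lim_sequentially not_less)
  then have "infinite {n. dist (X n) L \<ge> e}"
    by (simp add: infinite_nat_iff_unbounded_le)
  then obtain s :: "nat \<Rightarrow> nat" where s: "strict_mono s" "\<And>n. dist (X (s n)) L \<ge> e"
    using infinite_enumerate[of "{n. dist (X n) L \<ge> e}"] by auto
  then obtain r :: "nat \<Rightarrow> nat" where "(\<lambda>i. X (s (r i))) \<longlonglongrightarrow> L"
    using assms by blast
  then have "\<forall>\<^sub>F i in sequentially. dist (X (s (r i))) L < e"
    using e(1) by (rule tendstoD)
  then show False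
    using s(2) by (auto simp: eventually_sequentially not_less[symmetric])
qed

text \<open>Every subsequence of \<open>F\<close> still converges to \<open>f\<close> in mean, so
  the previous result yields a good further subsequence of it, and this forces convergence of the
  whole sequence.\<close>

lemma tendsto_integral_powr_growth:
  fixes h :: "real \<Rightarrow> real"
  assumes "p > 0" "continuous_on UNIV h" "\<And>a. \<bar>h a\<bar> \<le> \<gamma> * \<bar>a\<bar> powr p" "\<gamma> \<ge> 0"
    and "\<And>i. F i \<in> lp_space p" "f \<in> lp_space p"
    and lim: "(\<lambda>i. LINT x|lebesgue. \<bar>F i x - f x\<bar> powr p) \<longlonglongrightarrow> 0"
  shows "(\<lambda>i. LINT x|lebesgue. h (F i x)) \<longlonglongrightarrow> (LINT x|lebesgue. h (f x))"
proof (rule tendsto_of_subseq)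
  fix s :: "nat \<Rightarrow> nat"
  assume s: "strict_mono s"
  have "(\<lambda>i. LINT x|lebesgue. \<bar>F (s i) x - f x\<bar> powr p) \<longlonglongrightarrow> 0"
    using LIMSEQ_subseq_LIMSEQ[OF lim s] by (simp add: o_def)
  from tendsto_integral_powr_growth_subseq[OF assms(1-5) assms(6) this]
  show "\<exists>r :: nat \<Rightarrow> nat. strict_mono r \<and>
      (\<lambda>i. LINT x|lebesgue. h (F (s (r i)) x)) \<longlonglongrightarrow> (LINT x|lebesgue. h (f x))"
    by blast
qed

section \<open>Translation invariant valuations on real-valued functions\<close>

text \<open>The functional acts on functions instead of classes, and continuity is expressed by the
  \<open>p\<close>-th power of the norm, which tends to 0 exactly when the norm does.\<close>

locale real_lp_valuation =
  fixes p :: real and \<Psi> :: "(real ^ 'n \<Rightarrow> real) \<Rightarrow> real"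
  assumes p_pos: "p > 0"
    and zero: "\<Psi> (\<lambda>_. 0) = 0"
    and valuation: "\<And>u v. u \<in> lp_space p \<Longrightarrow> v \<in> lp_space p \<Longrightarrow>
      \<Psi> (\<lambda>x. max (u x) (v x)) + \<Psi> (\<lambda>x. min (u x) (v x)) = \<Psi> u + \<Psi> v"
    and cont: "\<And>F f. (\<And>i::nat. F i \<in> lp_space p) \<Longrightarrow> f \<in> lp_space p \<Longrightarrow>
      (\<lambda>i. LINT x|lebesgue. \<bar>F i x - f x\<bar> powr p) \<longlonglongrightarrow> 0 \<Longrightarrow> (\<lambda>i. \<Psi> (F i)) \<longlonglongrightarrow> \<Psi> f"
    and trans: "\<And>u t. u \<in> lp_space p \<Longrightarrow> \<Psi> (\<lambda>x. u (x - t)) = \<Psi> u"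
begin

text \<open>For nonnegative functions with disjoint supports the maximum is the sum and the minimum
  is 0.\<close>

lemma add_nonneg:
  assumes "u \<in> lp_space p" "v \<in> lp_space p" "\<And>x. u x = 0 \<or> v x = 0" "\<And>x. u x \<ge> 0" "\<And>x. v x \<ge> 0"
  shows "\<Psi> (\<lambda>x. u x + v x) = \<Psi> u + \<Psi> v"
proof -
  have "max (u x) (v x) = u x + v x" "min (u x) (v x) = 0" for x
    using assms(3-5)[of x] by auto
  then show ?thesis
    using valuation[OF assms(1,2)] zero by simp
qed

lemma add_nonpos:
  assumes "u \<in> lp_space p" "v \<in> lp_space p" "\<And>x. u x = 0 \<or> v x = 0" "\<And>x. u x \<le> 0" "\<And>x. v x \<le> 0"
  shows "\<Psi> (\<lambda>x. u x + v x) = \<Psi> u + \<Psi> v"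
proof -
  have "min (u x) (v x) = u x + v x" "max (u x) (v x) = 0" for x
    using assms(3-5)[of x] by auto
  then show ?thesis
    using valuation[OF assms(1,2)] zero by simp
qed

text \<open>With mixed signs the maximum need not be the sum. The valuation identity with 0 first
  splits each function into its positive and negative parts, which are then added
  separately.\<close>

lemma add_disjoint:
  assumes u: "u \<in> lp_space p" and v: "v \<in> lp_space p" and disj: "\<And>x. u x = 0 \<or> v x = 0"
  shows "\<Psi> (\<lambda>x. u x + v x) = \<Psi> u + \<Psi> v"
proof -
  have split: "\<Psi> w = \<Psi> (\<lambda>x. max (w x) 0) + \<Psi> (\<lambda>x. min (w x) 0)" if "w \<in> lp_space p" for w
    using valuation[OF that lp_space_zero] zero by simp
  note lp = lp_space_max_min[OF p_pos _ lp_space_zero]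
  have max: "max (u x + v x) 0 = max (u x) 0 + max (v x) 0"
    and min: "min (u x + v x) 0 = min (u x) 0 + min (v x) 0"
    and max0: "max (u x) 0 = 0 \<or> max (v x) 0 = 0"
    and min0: "min (u x) 0 = 0 \<or> min (v x) 0 = 0" for x
    using disj[of x] by auto
  have "\<Psi> (\<lambda>x. u x + v x)
      = \<Psi> (\<lambda>x. max (u x) 0 + max (v x) 0) + \<Psi> (\<lambda>x. min (u x) 0 + min (v x) 0)"
    using split[OF lp_space_add[OF p_pos u v]] by (simp only: max min)
  also have "\<Psi> (\<lambda>x. max (u x) 0 + max (v x) 0) = \<Psi> (\<lambda>x. max (u x) 0) + \<Psi> (\<lambda>x. max (v x) 0)"
    by (rule add_nonneg[OF lp(1)[OF u] lp(1)[OF v]]) (use max0 in auto)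
  also have "\<Psi> (\<lambda>x. min (u x) 0 + min (v x) 0) = \<Psi> (\<lambda>x. min (u x) 0) + \<Psi> (\<lambda>x. min (v x) 0)"
    by (rule add_nonpos[OF lp(2)[OF u] lp(2)[OF v]]) (use min0 in auto)
  finally show ?thesis
    using split[OF u] split[OF v] by simp
qed

lemma indicator_proportional:
  obtains c where "\<And>A. A \<in> lmeasurable \<Longrightarrow> \<Psi> (\<lambda>x. a * indicat_real A x) = c * measure lebesgue A"
proof (rule translation_invariant_additive_eq_measure[where \<nu> = "\<lambda>A. \<Psi> (\<lambda>x. a * indicat_real A x)"])
  fix A B :: "(real ^ 'n) set"
  assume AB: "A \<in> lmeasurable" "B \<in> lmeasurable" "A \<inter> B = {}"
  have "a * indicat_real (A \<union> B) x = a * indicat_real A x + a * indicat_real B x" for x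
    using AB(3) by (auto simp: indicator_def)
  then show "\<Psi> (\<lambda>x. a * indicat_real (A \<union> B) x)
      = \<Psi> (\<lambda>x. a * indicat_real A x) + \<Psi> (\<lambda>x. a * indicat_real B x)"
    using AB add_disjoint[OF lp_space_indicator(1)[OF AB(1)] lp_space_indicator(1)[OF AB(2)], of a a]
    by (auto simp: indicator_def)
next
  fix A :: "(real ^ 'n) set" and t
  assume A: "A \<in> lmeasurable"
  have "indicat_real ((+) t ` A) x = indicat_real A (x - t)" for x
    by (simp add: indicator_def mem_translation_iff)
  then show "\<Psi> (\<lambda>x. a * indicat_real ((+) t ` A) x) = \<Psi> (\<lambda>x. a * indicat_real A x)"
    using trans[OF lp_space_indicator(1)[OF A]] by simp
next
  fix A :: "nat \<Rightarrow> (real ^ 'n) set" and S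
  assume A: "\<And>i. A i \<in> lmeasurable" and S: "S \<in> lmeasurable"
    and lim: "(\<lambda>i. LINT x|lebesgue. \<bar>indicat_real (A i) x - indicat_real S x\<bar>) \<longlonglongrightarrow> 0"
  \<comment> \<open>Differences of indicators have absolute value 0 or 1 and are unchanged by the
    power; hence convergence in measure of the sets is convergence in the \<open>p\<close>-norm of
    the functions.\<close>
  have eq: "\<bar>a * indicat_real (A i) x - a * indicat_real S x\<bar> powr p
      = \<bar>a\<bar> powr p * \<bar>indicat_real (A i) x - indicat_real S x\<bar>" for i x
    by (auto simp: indicator_def)
  show "(\<lambda>i. \<Psi> (\<lambda>x. a * indicat_real (A i) x)) \<longlonglongrightarrow> \<Psi> (\<lambda>x. a * indicat_real S x)"
    by (rule cont) (use A S tendsto_mult_right_zero[OF lim] in \<open>auto simp: lp_space_indicator eq\<close>)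
next
  fix c
  assume "\<And>S :: (real ^ 'n) set. S \<in> lmeasurable \<Longrightarrow>
    \<Psi> (\<lambda>x. a * indicat_real S x) = c * measure lebesgue S"
  then show thesis
    by (rule that)
qed

text \<open>The unit cube has measure 1, so this value is the proportionality constant from
  \<open>indicator_proportional\<close>.\<close>

definition h :: "real \<Rightarrow> real" where
  "h a = \<Psi> (\<lambda>x. a * indicat_real (cbox 0 1) x)"

lemma measure_unit_cube: "measure lebesgue (cbox 0 1 :: (real ^ 'n) set) = 1"
  using content_cbox_cart[of 0 "1 :: real ^ 'n"] by (simp add: interval_eq_empty_cart)

lemma indicator_eq:
  assumes "A \<in> lmeasurable"
  shows "\<Psi> (\<lambda>x. a * indicat_real A x) = h a * measure lebesgue A"
proof -
  obtain c where c: "\<And>A. A \<in> lmeasurable \<Longrightarrow> \<Psi> (\<lambda>x. a * indicat_real A x) = c * measure lebesgue A"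
    using indicator_proportional[of a] by blast
  have "c = h a"
    using c[of "cbox 0 1"] measure_unit_cube by (simp add: h_def)
  then show ?thesis
    using c assms by simp
qed

lemma h_zero: "h 0 = 0"
  using zero by (simp add: h_def)

text \<open>The multiples \<open>s i\<close> and \<open>a\<close> of the indicator of the unit cube
  have distance \<open>\<bar>s i - a\<bar>\<close> in the \<open>p\<close>-norm, so continuity of
  \<open>\<Psi>\<close> passes to \<open>h\<close>.\<close>

lemma h_continuous: "continuous_on UNIV h"
proof (rule continuous_at_imp_continuous_on, rule ballI)
  fix a
  have "(\<lambda>i. h (s i)) \<longlonglongrightarrow> h a" if s: "s \<longlonglongrightarrow> a" for s
    unfolding h_def
  proof (rule cont)
    have eq: "\<bar>s i * indicat_real (cbox 0 1) x - a * indicat_real (cbox 0 1) x\<bar> powr p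
        = \<bar>(s i - a) * indicat_real (cbox 0 1) x\<bar> powr p" for i and x :: "real ^ 'n"
      by (simp add: left_diff_distrib)
    have "(\<lambda>i. \<bar>s i - a\<bar> powr p) \<longlonglongrightarrow> 0 powr p"
      using s p_pos by (intro tendsto_powr2) (auto simp: LIM_zero tendsto_rabs_zero)
    then show "(\<lambda>i. LINT x|lebesgue. \<bar>s i * indicat_real (cbox 0 1) x
        - a * indicat_real (cbox 0 1 :: (real ^ 'n) set) x\<bar> powr p) \<longlonglongrightarrow> 0"
      unfolding eq by (simp add: lp_space_indicator measure_unit_cube)
  qed (auto simp: lp_space_indicator)
  then show "isCont h a"
    by (auto simp: isCont_def tendsto_at_iff_sequentially o_def)
qed

lemma cube_of_measure:
  assumes "s > 0"
  obtains A :: "(real ^ 'n) set" where "A \<in> lmeasurable" "measure lebesgue A = s"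
proof
  let ?A = "cbox 0 (\<chi> i. root CARD('n) s) :: (real ^ 'n) set"
  have "?A \<noteq> {}"
    using assms by (simp add: interval_eq_empty_cart not_less)
  then show "measure lebesgue ?A = s"
    using assms content_cbox_cart[of 0 "(\<chi> i. root CARD('n) s) :: real ^ 'n"] by simp
qed simp

lemma h_growth: "\<exists>\<gamma>\<ge>0. \<forall>a. \<bar>h a\<bar> \<le> \<gamma> * \<bar>a\<bar> powr p"
proof (rule ccontr)
  assume neg: "\<not> ?thesis"
  have "\<exists>a. \<bar>h a\<bar> > real (Suc k) * \<bar>a\<bar> powr p" for k
    using neg of_nat_0_le_iff[of "Suc k"] not_less by blast
  then obtain a where a: "\<And>k. \<bar>h (a k)\<bar> > real (Suc k) * \<bar>a k\<bar> powr p"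
    by metis
  \<comment> \<open>The strict inequality fails at 0 because \<open>h 0 = 0\<close>; this makes the
    division by \<open>\<bar>a k\<bar> powr p\<close> below legitimate.\<close>
  have "a k \<noteq> 0" for k
    using a[of k] h_zero by auto
  then have pos: "\<bar>a k\<bar> powr p > 0" for k
    by simp
  \<comment> \<open>With this measure the \<open>p\<close>-th powers integrate to
    \<open>1 / Suc k\<close>, which tends to 0, while \<open>\<bar>h (a k)\<bar>\<close> times the
    measure exceeds 1 by the choice of \<open>a k\<close>.\<close>
  have "\<exists>A :: (real ^ 'n) set. A \<in> lmeasurable \<and> measure lebesgue A = 1 / (real (Suc k) * \<bar>a k\<bar> powr p)" for k
    by (rule cube_of_measure[of "1 / (real (Suc k) * \<bar>a k\<bar> powr p)"]) (use pos[of k] in auto)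
  then obtain A :: "nat \<Rightarrow> (real ^ 'n) set" where A: "\<And>k. A k \<in> lmeasurable"
      "\<And>k. measure lebesgue (A k) = 1 / (real (Suc k) * \<bar>a k\<bar> powr p)"
    by metis
  have "(\<lambda>k. \<Psi> (\<lambda>x. a k * indicat_real (A k) x)) \<longlonglongrightarrow> \<Psi> (\<lambda>_. 0)"
  proof (rule cont)
    have "(LINT x|lebesgue. \<bar>a k * indicat_real (A k) x\<bar> powr p) = 1 / Suc k" for k
      using pos[of k] by (simp add: lp_space_indicator A del: of_nat_Suc)
    then show "(\<lambda>k. LINT x|lebesgue. \<bar>a k * indicat_real (A k) x - 0\<bar> powr p) \<longlonglongrightarrow> 0"
      using LIMSEQ_Suc[OF lim_const_over_n[of 1]] by simp
  qed (auto simp: lp_space_indicator A)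
  then have "(\<lambda>k. \<bar>h (a k) * measure lebesgue (A k)\<bar>) \<longlonglongrightarrow> 0"
    using zero by (simp add: indicator_eq A(1) tendsto_rabs_zero)
  then have "\<forall>\<^sub>F k in sequentially. \<bar>h (a k) * measure lebesgue (A k)\<bar> < 1"
    by (rule order_tendstoD) simp
  moreover have "\<bar>h (a k) * measure lebesgue (A k)\<bar> > 1" for k
  proof -
    let ?d = "real (Suc k) * \<bar>a k\<bar> powr p"
    have d: "?d > 0"
      using pos[of k] by (simp del: of_nat_Suc)
    then have "1 = ?d * measure lebesgue (A k)"
      unfolding A(2) by (metis less_numeral_extra(3) nonzero_mult_div_cancel_left times_divide_eq_right mult.right_neutral)
    also have "\<dots> < \<bar>h (a k)\<bar> * measure lebesgue (A k)"
      using a[of k] d by (intro mult_strict_right_mono) (simp_all only: A(2) zero_less_divide_1_iff)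
    finally show ?thesis
      by (simp add: abs_mult)
  qed
  ultimately show False
    by (auto simp: eventually_sequentially not_less[symmetric] dest: less_asym)
qed

text \<open>Induction over the finitely many nonzero values. The value 0 is left out because its
  fibre has infinite measure; it contributes nothing since \<open>h 0 = 0\<close>.\<close>

lemma simple_eq:
  assumes s: "simple_function lebesgue s" "s \<in> lp_space p"
  shows "\<Psi> s = (LINT x|lebesgue. h (s x))"
proof -
  obtain \<gamma> where \<gamma>: "\<And>a. \<bar>h a\<bar> \<le> \<gamma> * \<bar>a\<bar> powr p"
    using h_growth by blast
  define T where "T V x = (if s x \<in> V then s x else 0)" for V x
  have fib[measurable]: "s -` V \<in> sets lebesgue" for V
    using simple_functionD(2)[OF s(1), of V] by simp
  have T: "T V \<in> lp_space p" for V
  proof (rule lp_space_dominated[OF p_pos _ s(2), of _ 1])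
    have "T V = (\<lambda>x. indicat_real (s -` V) x * s x)"
      by (auto simp: T_def fun_eq_iff)
    then show "T V \<in> borel_measurable lebesgue"
      using lp_spaceD(1)[OF s(2)] by simp
  qed (auto simp: T_def)
  \<comment> \<open>The indicator of the fibre times \<open>\<bar>a\<bar> powr p\<close> is
    dominated by the integrable function \<open>\<bar>s\<bar> powr p\<close>.\<close>
  have fib_lm: "s -` {a} \<in> lmeasurable" if "a \<noteq> 0" for a
  proof -
    have "integrable lebesgue (\<lambda>x. \<bar>a\<bar> powr p * indicat_real (s -` {a}) x)"
    proof (rule Bochner_Integration.integrable_bound[OF lp_spaceD(2)[OF s(2)]])
      show "(\<lambda>x. \<bar>a\<bar> powr p * indicat_real (s -` {a}) x) \<in> borel_measurable lebesgue"
        by measurable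
      show "AE x in lebesgue. norm (\<bar>a\<bar> powr p * indicat_real (s -` {a}) x) \<le> norm (norm (s x) powr p)"
        by (rule AE_I2) (simp add: indicator_def)
    qed
    then have "integrable lebesgue (indicat_real (s -` {a}))"
      using that by simp
    then show ?thesis
      using fib by (simp add: integrable_indicator_iff fmeasurable_def)
  qed
  have "\<Psi> (T V) = (LINT x|lebesgue. h (T V x))" if "finite V" "0 \<notin> V" for V
    using that
  proof induction
    case empty
    then show ?case
      by (simp add: T_def[abs_def] zero h_zero)
  next
    case (insert a V)
    let ?A = "s -` {a}"
    have A: "?A \<in> lmeasurable"
      using insert by (intro fib_lm) auto
    have "T (insert a V) = (\<lambda>x. T V x + a * indicat_real ?A x)"
      using insert by (auto simp: T_def indicator_def fun_eq_iff)
    moreover have "T V x = 0 \<or> a * indicat_real ?A x = 0" for x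
      using insert by (auto simp: T_def indicator_def)
    ultimately have "\<Psi> (T (insert a V)) = \<Psi> (T V) + h a * measure lebesgue ?A"
      using add_disjoint[OF T lp_space_indicator(1)[OF A]] indicator_eq[OF A] by simp
    also have "\<dots> = (LINT x|lebesgue. h (T V x)) + (LINT x|lebesgue. h a * indicat_real ?A x)"
      using insert by simp
    also have "\<dots> = (LINT x|lebesgue. h (T V x) + h a * indicat_real ?A x)"
      using A integrable_powr_growth[OF h_continuous \<gamma> T]
      by (subst Bochner_Integration.integral_add) (auto simp: fmeasurable_def)
    also have "(\<lambda>x. h (T V x) + h a * indicat_real ?A x) = (\<lambda>x. h (T (insert a V) x))"
      using insert by (auto simp: T_def indicator_def fun_eq_iff h_zero)
    finally show ?case .
  qed
  \<comment> \<open>Dropping the value 0 changes nothing, as 0 is also the default of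
    \<open>T\<close>.\<close>
  moreover have "T (range s - {0}) = s"
    by (auto simp: T_def fun_eq_iff)
  moreover have "finite (range s - {0})"
    using simple_functionD(1)[OF s(1)] by simp
  ultimately show ?thesis
    by (metis Diff_iff singletonI)
qed

text \<open>Both sides are continuous in the \<open>p\<close>-norm and agree on simple functions,
  which approximate \<open>u\<close>.\<close>

lemma representation:
  assumes u: "u \<in> lp_space p"
  shows "\<Psi> u = (LINT x|lebesgue. h (u x))"
proof -
  obtain \<gamma> where \<gamma>: "\<gamma> \<ge> 0" "\<And>a. \<bar>h a\<bar> \<le> \<gamma> * \<bar>a\<bar> powr p"
    using h_growth by blast
  note [measurable] = lp_spaceD(1)[OF u]
  obtain s where s: "\<And>i. simple_function lebesgue (s i)" "\<And>x. (\<lambda>i. s i x) \<longlonglongrightarrow> u x"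
      "\<And>i x. \<bar>s i x\<bar> \<le> 2 * \<bar>u x\<bar>"
    using borel_measurable_implies_sequence_metric[OF lp_spaceD(1)[OF u], of 0] by auto
  have s_lp: "s i \<in> lp_space p" for i
    by (rule lp_space_dominated[OF p_pos _ u, of _ 2]) (simp_all add: s(1,3) borel_measurable_simple_function)
  note [measurable] = lp_spaceD(1)[OF s_lp]
  have "(\<lambda>i. LINT x|lebesgue. \<bar>s i x - u x\<bar> powr p) \<longlonglongrightarrow> (LINT x::real^'n|lebesgue. (0::real))"
  \<comment> \<open>The factor 3 comes from
    \<open>\<bar>s i x\<bar> \<le> 2 * \<bar>u x\<bar>\<close> and the triangle inequality.\<close>
  proof (rule integral_dominated_convergence[where w = "\<lambda>x. 3 powr p * \<bar>u x\<bar> powr p"])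
    show "integrable lebesgue (\<lambda>x. 3 powr p * \<bar>u x\<bar> powr p)"
      using lp_spaceD(2)[OF u] by simp
    have "(\<lambda>i. \<bar>s i x - u x\<bar> powr p) \<longlonglongrightarrow> 0 powr p" for x
      using s(2)[of x] p_pos by (intro tendsto_powr2) (auto simp: LIM_zero tendsto_rabs_zero)
    then show "AE x in lebesgue. (\<lambda>i. \<bar>s i x - u x\<bar> powr p) \<longlonglongrightarrow> 0"
      by simp
    have "\<bar>s i x - u x\<bar> powr p \<le> (3 * \<bar>u x\<bar>) powr p" for i x
      using s(3)[of i x] p_pos by (intro powr_mono2) auto
    then show "AE x in lebesgue. norm (\<bar>s i x - u x\<bar> powr p) \<le> 3 powr p * \<bar>u x\<bar> powr p" for i
      by (simp add: powr_mult)
  qed auto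
  then have lim: "(\<lambda>i. LINT x|lebesgue. \<bar>s i x - u x\<bar> powr p) \<longlonglongrightarrow> 0"
    by simp
  have "(\<lambda>i. \<Psi> (s i)) \<longlonglongrightarrow> \<Psi> u"
    by (rule cont[OF s_lp u lim])
  moreover have "(\<lambda>i. \<Psi> (s i)) \<longlonglongrightarrow> (LINT x|lebesgue. h (u x))"
    unfolding simple_eq[OF s(1) s_lp]
    by (rule tendsto_integral_powr_growth[OF p_pos h_continuous \<gamma>(2,1) s_lp u lim])
  ultimately show ?thesis
    by (rule LIMSEQ_unique)
qed

end

section \<open>Complex-valued functions\<close>

lemma lp_fun_eq_lp_space: "lp_fun p = lp_space p"
  by (simp add: lp_fun_def lp_space_def)

lemma lp_norm_tendsto_zero_iff:
  assumes "p > 0"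
  shows "(\<lambda>i. lp_norm p (F i)) \<longlonglongrightarrow> 0 \<longleftrightarrow> (\<lambda>i. LINT x|lebesgue. cmod (F i x) powr p) \<longlonglongrightarrow> 0"
proof
  have "lp_norm p (F i) powr p = (LINT x|lebesgue. cmod (F i x) powr p)" for i
    using assms by (simp add: lp_norm_def powr_powr)
  moreover assume "(\<lambda>i. lp_norm p (F i)) \<longlonglongrightarrow> 0"
  then have "(\<lambda>i. lp_norm p (F i) powr p) \<longlonglongrightarrow> 0 powr p"
    using assms by (intro tendsto_powr2) (auto simp: lp_norm_def)
  ultimately show "(\<lambda>i. LINT x|lebesgue. cmod (F i x) powr p) \<longlonglongrightarrow> 0"
    by simp
next
  assume "(\<lambda>i. LINT x|lebesgue. cmod (F i x) powr p) \<longlonglongrightarrow> 0"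
  then have "(\<lambda>i. (LINT x|lebesgue. cmod (F i x) powr p) powr (1 / p)) \<longlonglongrightarrow> 0 powr (1 / p)"
    using assms by (intro tendsto_powr2) auto
  then show "(\<lambda>i. lp_norm p (F i)) \<longlonglongrightarrow> 0"
    by (simp add: lp_norm_def)
qed

lemma lp_fun_component:
  assumes "p > 0" "f \<in> lp_fun p" "T \<in> {Re, Im}"
  shows "(\<lambda>x. T (f x)) \<in> lp_space p"
proof (rule lp_space_dominated[where g = f and C = 1])
  show "(\<lambda>x. T (f x)) \<in> borel_measurable lebesgue"
    using assms by (auto simp: lp_fun_def)
qed (use assms in \<open>auto simp: lp_fun_eq_lp_space abs_Re_le_cmod abs_Im_le_cmod\<close>)

lemma lp_fun_embed:
  assumes "p > 0" "u \<in> lp_space p" "E \<in> {\<lambda>a. Complex a 0, Complex 0}"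
  shows "(\<lambda>x. E (u x)) \<in> lp_fun p"
  unfolding lp_fun_eq_lp_space
proof (rule lp_space_dominated[where g = u and C = 1])
  have "Complex a 0 = of_real a" "Complex 0 a = \<i> * of_real a" for a
    by (simp_all add: complex_eq_iff)
  then show "(\<lambda>x. E (u x)) \<in> borel_measurable lebesgue"
    using assms(3) lp_spaceD(1)[OF assms(2)] by auto
  show "norm (E (u x)) \<le> 1 * norm (u x)" for x
    using assms(3) by (auto simp: cmod_def)
qed (use assms in auto)

lemma lp_continuousD:
  assumes "lp_continuous p \<Phi>" "\<And>i. F i \<in> lp_fun p" "f \<in> lp_fun p"
    and "(\<lambda>i. lp_norm p (\<lambda>x. F i x - f x)) \<longlonglongrightarrow> 0"
  shows "(\<lambda>i. \<Phi> (lp_class p (F i))) \<longlonglongrightarrow> \<Phi> (lp_class p f)"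
  using assms by (simp add: lp_continuous_def)

text \<open>The parameter \<open>E\<close> ranges over the embeddings of the reals as real or
  imaginary axis, and \<open>T\<close> over the two parts of the value, so one proof serves all four
  real functionals. It works because \<open>E\<close> is isometric and turns maximum and minimum
  into join and meet.\<close>

lemma real_lp_valuation_component:
  fixes \<Phi> :: "(real ^ 'n \<Rightarrow> complex) set \<Rightarrow> complex"
  assumes p: "p > 0"
    and \<Phi>: "lp_continuous p \<Phi>" "lp_translation_invariant p \<Phi>" "lp_valuation p \<Phi>"
    and E: "E \<in> {\<lambda>a. Complex a 0, Complex 0}" and T: "T \<in> {Re, Im}"
  shows "real_lp_valuation p (\<lambda>u. T (\<Phi> (lp_class p (\<lambda>x. E (u x)))))"
proof
  have E0: "E 0 = 0"
    using E by (auto simp: complex_eq_iff)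
  have normE: "cmod (E a - E b) = \<bar>a - b\<bar>" for a b
    using E by (auto simp: cmod_def)
  have T_add: "T (w + z) = T w + T z" for w z
    using T by auto
  show "T (\<Phi> (lp_class p (\<lambda>x. E 0))) = 0"
    using \<Phi>(3) T by (auto simp: E0 lp_valuation_def)
  show "T (\<Phi> (lp_class p (\<lambda>x. E (max (u x) (v x))))) + T (\<Phi> (lp_class p (\<lambda>x. E (min (u x) (v x)))))
      = T (\<Phi> (lp_class p (\<lambda>x. E (u x)))) + T (\<Phi> (lp_class p (\<lambda>x. E (v x))))"
    if "u \<in> lp_space p" "v \<in> lp_space p" for u v :: "real ^ 'n \<Rightarrow> real"
  proof -
    have "fun_join (\<lambda>x. E (u x)) (\<lambda>x. E (v x)) = (\<lambda>x. E (max (u x) (v x)))"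
      "fun_meet (\<lambda>x. E (u x)) (\<lambda>x. E (v x)) = (\<lambda>x. E (min (u x) (v x)))"
      using E by (auto simp: fun_join_def fun_meet_def)
    then show ?thesis
      using \<Phi>(3) lp_fun_embed[OF p that(1) E] lp_fun_embed[OF p that(2) E]
      unfolding lp_valuation_def T_add[symmetric] by metis
  qed
  show "(\<lambda>i. T (\<Phi> (lp_class p (\<lambda>x. E (F i x))))) \<longlonglongrightarrow> T (\<Phi> (lp_class p (\<lambda>x. E (f x))))"
    if "\<And>i::nat. F i \<in> lp_space p" "f \<in> lp_space p"
      "(\<lambda>i. LINT x|lebesgue. \<bar>F i x - f x\<bar> powr p) \<longlonglongrightarrow> 0"
    for F and f :: "real ^ 'n \<Rightarrow> real"
  proof -
    have "(\<lambda>i. lp_norm p (\<lambda>x. E (F i x) - E (f x))) \<longlonglongrightarrow> 0"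
      using that(3) by (simp add: lp_norm_tendsto_zero_iff[OF p] normE)
    then have lim: "(\<lambda>i. \<Phi> (lp_class p (\<lambda>x. E (F i x)))) \<longlonglongrightarrow> \<Phi> (lp_class p (\<lambda>x. E (f x)))"
      using lp_fun_embed[OF p that(1) E] lp_fun_embed[OF p that(2) E]
      by (intro lp_continuousD[OF \<Phi>(1), of "\<lambda>i x. E (F i x)" "\<lambda>x. E (f x)"])
    show ?thesis
      using T tendsto_Re[OF lim] tendsto_Im[OF lim] by blast
  qed
  show "T (\<Phi> (lp_class p (\<lambda>x. E (u (x - t))))) = T (\<Phi> (lp_class p (\<lambda>x. E (u x))))"
    if "u \<in> lp_space p" for u and t :: "real ^ 'n"
    using \<Phi>(2)[unfolded lp_translation_invariant_def, rule_format, OF lp_fun_embed[OF p that E], of t] by simp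
qed (fact p)

lemma real_component_representation:
  fixes \<Phi> :: "(real ^ 'n \<Rightarrow> complex) set \<Rightarrow> complex"
  assumes "p > 0" "lp_continuous p \<Phi>" "lp_translation_invariant p \<Phi>" "lp_valuation p \<Phi>"
    and "E \<in> {\<lambda>a. Complex a 0, Complex 0}" "T \<in> {Re, Im}"
  obtains h :: "real \<Rightarrow> real" where "continuous_on UNIV h" "\<exists>\<gamma>\<ge>0. \<forall>a. \<bar>h a\<bar> \<le> \<gamma> * \<bar>a\<bar> powr p"
    "\<And>u. u \<in> lp_space p \<Longrightarrow> T (\<Phi> (lp_class p (\<lambda>x. E (u x)))) = (LINT x|lebesgue. h (u x))"
proof -
  interpret real_lp_valuation p "\<lambda>u. T (\<Phi> (lp_class p (\<lambda>x. E (u x))))"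
    by (rule real_lp_valuation_component[OF assms])
  show ?thesis
    using that[OF h_continuous h_growth representation] .
qed

lemma lp_valuation_split:
  fixes \<Phi> :: "(real ^ 'n \<Rightarrow> complex) set \<Rightarrow> complex"
  assumes "p > 0" "lp_valuation p \<Phi>" "f \<in> lp_fun p"
  shows "\<Phi> (lp_class p f)
    = \<Phi> (lp_class p (\<lambda>x. Complex (Re (f x)) 0)) + \<Phi> (lp_class p (\<lambda>x. Complex 0 (Im (f x))))"
proof -
  let ?u = "\<lambda>x. Complex (Re (f x)) 0" and ?v = "\<lambda>x. Complex 0 (Im (f x))"
  have val: "\<Phi> (lp_class p (fun_join g k)) + \<Phi> (lp_class p (fun_meet g k))
      = \<Phi> (lp_class p g) + \<Phi> (lp_class p k)" if "g \<in> lp_fun p" "k \<in> lp_fun p" for g k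
    using assms(2) that by (simp add: lp_valuation_def)
  have "?u \<in> lp_fun p" "?v \<in> lp_fun p"
    using lp_fun_embed[OF assms(1) lp_fun_component[OF assms(1,3)]] by auto
  moreover have "(\<lambda>_ :: real ^ 'n. 0) \<in> lp_fun p"
    by (simp add: lp_fun_eq_lp_space)
  \<comment> \<open>In each coordinate both pairs consist of a part of \<open>f\<close> and 0, only
    in a different order.\<close>
  moreover have "fun_join ?u ?v = fun_join f (\<lambda>_. 0)" "fun_meet ?u ?v = fun_meet f (\<lambda>_. 0)"
    by (simp_all add: fun_join_def fun_meet_def max.commute min.commute)
  moreover have "\<Phi> (lp_class p (\<lambda>_. 0)) = 0"
    using assms(2) by (simp add: lp_valuation_def)
  ultimately show ?thesis
    using val[of ?u ?v] val[of f "\<lambda>_. 0"] assms(3) by simp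
qed

text \<open>Set up for the converse direction: the real part of the integral formula comes from one
  pair of integrands and the imaginary part from another, so each property is proved once and used
  for both.\<close>

locale powr_growth_pair =
  fixes p :: real and h g :: "real \<Rightarrow> real" and \<gamma> \<delta> :: real
  assumes p_pos: "p > 0"
    and h: "continuous_on UNIV h" "\<And>a. \<bar>h a\<bar> \<le> \<gamma> * \<bar>a\<bar> powr p" "\<gamma> \<ge> 0"
    and g: "continuous_on UNIV g" "\<And>a. \<bar>g a\<bar> \<le> \<delta> * \<bar>a\<bar> powr p" "\<delta> \<ge> 0"
begin

definition J :: "(real ^ 'n \<Rightarrow> complex) \<Rightarrow> real" where
  "J f = (LINT x|lebesgue. h (Re (f x)) + g (Im (f x)))"

lemma integrable_parts:
  assumes "f \<in> lp_fun p"
  shows "integrable lebesgue (\<lambda>x. h (Re (f x)))" "integrable lebesgue (\<lambda>x. g (Im (f x)))"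
  using integrable_powr_growth[OF h(1,2) lp_fun_component[OF p_pos assms, of Re]]
    integrable_powr_growth[OF g(1,2) lp_fun_component[OF p_pos assms, of Im]] by simp_all

lemma J_eq:
  assumes "f \<in> lp_fun p"
  shows "J f = (LINT x|lebesgue. h (Re (f x))) + (LINT x|lebesgue. g (Im (f x)))"
  unfolding J_def using integrable_parts[OF assms] by simp

lemma J_zero: "J (\<lambda>_. 0) = 0"
proof -
  have "h 0 = 0" "g 0 = 0"
    using h(2)[of 0] g(2)[of 0] by simp_all
  then show ?thesis
    by (simp add: J_def)
qed

lemma J_translation:
  assumes "f \<in> lp_fun p"
  shows "J (\<lambda>x. f (x - t)) = J f"
  unfolding J_def
  using lebesgue_integral_translation[of "\<lambda>x. h (Re (f x)) + g (Im (f x))" t] integrable_parts[OF assms]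
  by simp

lemma J_valuation:
  assumes f: "f \<in> lp_fun p" "k \<in> lp_fun p" and "fun_join f k \<in> lp_fun p" "fun_meet f k \<in> lp_fun p"
  shows "J (fun_join f k) + J (fun_meet f k) = J f + J k"
proof -
  \<comment> \<open>Maximum and minimum merely reorder \<open>a\<close> and \<open>b\<close>; thus
    the valuation identity holds pointwise under the integral for any integrand.\<close>
  have *: "\<phi> (max a b) + \<phi> (min a b) = \<phi> a + \<phi> b" for \<phi> :: "real \<Rightarrow> real" and a b
    by (simp add: max_def min_def)
  have "J (fun_join f k) + J (fun_meet f k)
      = (LINT x|lebesgue. (h (Re (fun_join f k x)) + g (Im (fun_join f k x)))
                        + (h (Re (fun_meet f k x)) + g (Im (fun_meet f k x))))"
    unfolding J_def using assms integrable_parts by (subst Bochner_Integration.integral_add) auto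
  also have "\<dots> = (LINT x|lebesgue. (h (Re (f x)) + g (Im (f x))) + (h (Re (k x)) + g (Im (k x))))"
  proof (rule Bochner_Integration.integral_cong)
    fix x
    show "(h (Re (fun_join f k x)) + g (Im (fun_join f k x)))
        + (h (Re (fun_meet f k x)) + g (Im (fun_meet f k x)))
        = (h (Re (f x)) + g (Im (f x))) + (h (Re (k x)) + g (Im (k x)))"
      using *[of h "Re (f x)" "Re (k x)"] *[of g "Im (f x)" "Im (k x)"]
      by (simp add: fun_join_def fun_meet_def)
  qed simp
  also have "\<dots> = J f + J k"
    unfolding J_def using assms integrable_parts by (subst Bochner_Integration.integral_add) auto
  finally show ?thesis .
qed

lemma component_tendsto:
  assumes F: "\<And>i. F i \<in> lp_fun p" and f: "f \<in> lp_fun p" and T: "T \<in> {Re, Im}"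
    and lim: "(\<lambda>i. lp_norm p (\<lambda>x. F i x - f x)) \<longlonglongrightarrow> 0"
  shows "(\<lambda>i. LINT x|lebesgue. \<bar>T (F i x) - T (f x)\<bar> powr p) \<longlonglongrightarrow> 0"
proof (rule Lim_null_comparison[rotated])
  show "(\<lambda>i. LINT x|lebesgue. cmod (F i x - f x) powr p) \<longlonglongrightarrow> 0"
    using lim by (simp add: lp_norm_tendsto_zero_iff[OF p_pos])
  have "(LINT x|lebesgue. \<bar>T (F i x) - T (f x)\<bar> powr p) \<le> (LINT x|lebesgue. cmod (F i x - f x) powr p)" for i
  proof (rule integral_mono)
    show "integrable lebesgue (\<lambda>x. \<bar>T (F i x) - T (f x)\<bar> powr p)"
      using lp_spaceD(2)[OF lp_space_diff[OF p_pos lp_fun_component[OF p_pos F T] lp_fun_component[OF p_pos f T]]]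
      by simp
    show "integrable lebesgue (\<lambda>x. cmod (F i x - f x) powr p)"
      using lp_spaceD(2)[OF lp_space_diff[OF p_pos]] F f unfolding lp_fun_eq_lp_space by blast
    show "\<bar>T (F i x) - T (f x)\<bar> powr p \<le> cmod (F i x - f x) powr p" for x
      using p_pos T abs_Re_le_cmod[of "F i x - f x"] abs_Im_le_cmod[of "F i x - f x"]
      by (intro powr_mono2) auto
  qed
  then show "\<forall>\<^sub>F i in sequentially. norm (LINT x|lebesgue. \<bar>T (F i x) - T (f x)\<bar> powr p)
      \<le> (LINT x|lebesgue. cmod (F i x - f x) powr p)"
    by (simp add: always_eventually)
qed

lemma J_continuous:
  assumes F: "\<And>i. F i \<in> lp_fun p" and f: "f \<in> lp_fun p"
    and lim: "(\<lambda>i. lp_norm p (\<lambda>x. F i x - f x)) \<longlonglongrightarrow> 0"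
  shows "(\<lambda>i. J (F i)) \<longlonglongrightarrow> J f"
  unfolding J_eq[OF F] J_eq[OF f]
proof (rule tendsto_add)
  show "(\<lambda>i. LINT x|lebesgue. h (Re (F i x))) \<longlonglongrightarrow> (LINT x|lebesgue. h (Re (f x)))"
    by (rule tendsto_integral_powr_growth[OF p_pos h])
      (use component_tendsto[OF F f _ lim, of Re] lp_fun_component[OF p_pos F, of Re]
        lp_fun_component[OF p_pos f, of Re] in auto)
  show "(\<lambda>i. LINT x|lebesgue. g (Im (F i x))) \<longlonglongrightarrow> (LINT x|lebesgue. g (Im (f x)))"
    by (rule tendsto_integral_powr_growth[OF p_pos g])
      (use component_tendsto[OF F f _ lim, of Im] lp_fun_component[OF p_pos F, of Im]
        lp_fun_component[OF p_pos f, of Im] in auto)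
qed

end

lemma lp_fun_join_meet:
  fixes f g :: "real ^ 'n \<Rightarrow> complex"
  assumes "p > 0" "f \<in> lp_fun p" "g \<in> lp_fun p"
  shows "fun_join f g \<in> lp_fun p" "fun_meet f g \<in> lp_fun p"
proof -
  have "(\<lambda>x. Complex (u x) (v x)) \<in> lp_fun p" if "u \<in> lp_space p" "v \<in> lp_space p" for u v :: "real ^ 'n \<Rightarrow> real"
  proof -
    have "(\<lambda>x. Complex (u x) (v x)) = (\<lambda>x. Complex (u x) 0 + Complex 0 (v x))"
      by (simp add: fun_eq_iff complex_eq_iff)
    moreover have "(\<lambda>x. Complex (u x) 0) \<in> lp_space p" "(\<lambda>x. Complex 0 (v x)) \<in> lp_space p"
      using lp_fun_embed[OF assms(1) that(1), of "\<lambda>a. Complex a 0"]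
        lp_fun_embed[OF assms(1) that(2), of "Complex 0"] by (simp_all add: lp_fun_eq_lp_space)
    ultimately show ?thesis
      using lp_space_add[OF assms(1)] by (simp add: lp_fun_eq_lp_space)
  qed
  then show "fun_join f g \<in> lp_fun p" "fun_meet f g \<in> lp_fun p"
    unfolding fun_join_def fun_meet_def
    by (simp_all add: lp_space_max_min lp_fun_component assms)
qed

theorem theorem1p2:
  fixes p :: real and \<Phi> :: "(real ^ 'n \<Rightarrow> complex) set \<Rightarrow> complex"
  assumes "p \<ge> 1"
  shows "(lp_continuous p \<Phi> \<and> lp_translation_invariant p \<Phi> \<and> lp_valuation p \<Phi>) \<longleftrightarrow>
    (\<exists>h :: nat \<Rightarrow> real \<Rightarrow> real.
       (\<forall>k \<in> {1..4}. continuous_on UNIV (h k) \<and>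
          (\<exists>\<gamma>\<ge>0. \<forall>a. \<bar>h k a\<bar> \<le> \<gamma> * \<bar>a\<bar> powr p)) \<and>
       (\<forall>f \<in> lp_fun p. \<Phi> (lp_class p f) =
          complex_of_real (LINT x|lebesgue. h 1 (Re (f x)) + h 3 (Im (f x))) +
          \<i> * complex_of_real (LINT x|lebesgue. h 2 (Re (f x)) + h 4 (Im (f x)))))"
    (is "?lhs \<longleftrightarrow> (\<exists>h. ?growth h \<and> ?rep h)")
proof
  assume ?lhs
  have p: "p > 0"
    using assms by simp
  have range: "{1..4} = {1, 2, 3, 4 :: nat}"
    by auto
  have \<Phi>: "lp_continuous p \<Phi>" "lp_translation_invariant p \<Phi>" "lp_valuation p \<Phi>"
    using \<open>?lhs\<close> by auto
  note rep = real_component_representation[OF p \<Phi>]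
  obtain h1 where h1: "continuous_on UNIV h1" "\<exists>\<gamma>\<ge>0. \<forall>a. \<bar>h1 a\<bar> \<le> \<gamma> * \<bar>a\<bar> powr p"
    "\<And>u. u \<in> lp_space p \<Longrightarrow> Re (\<Phi> (lp_class p (\<lambda>x. Complex (u x) 0))) = (LINT x|lebesgue. h1 (u x))"
    by (rule rep[of "\<lambda>a. Complex a 0" Re]) auto
  obtain h2 where h2: "continuous_on UNIV h2" "\<exists>\<gamma>\<ge>0. \<forall>a. \<bar>h2 a\<bar> \<le> \<gamma> * \<bar>a\<bar> powr p"
    "\<And>u. u \<in> lp_space p \<Longrightarrow> Im (\<Phi> (lp_class p (\<lambda>x. Complex (u x) 0))) = (LINT x|lebesgue. h2 (u x))"
    by (rule rep[of "\<lambda>a. Complex a 0" Im]) auto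
  obtain h3 where h3: "continuous_on UNIV h3" "\<exists>\<gamma>\<ge>0. \<forall>a. \<bar>h3 a\<bar> \<le> \<gamma> * \<bar>a\<bar> powr p"
    "\<And>u. u \<in> lp_space p \<Longrightarrow> Re (\<Phi> (lp_class p (\<lambda>x. Complex 0 (u x)))) = (LINT x|lebesgue. h3 (u x))"
    by (rule rep[of "Complex 0" Re]) auto
  obtain h4 where h4: "continuous_on UNIV h4" "\<exists>\<gamma>\<ge>0. \<forall>a. \<bar>h4 a\<bar> \<le> \<gamma> * \<bar>a\<bar> powr p"
    "\<And>u. u \<in> lp_space p \<Longrightarrow> Im (\<Phi> (lp_class p (\<lambda>x. Complex 0 (u x)))) = (LINT x|lebesgue. h4 (u x))"
    by (rule rep[of "Complex 0" Im]) auto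
  define h where "h = (\<lambda>k::nat. if k = 1 then h1 else if k = 2 then h2 else if k = 3 then h3 else h4)"
  have h_simps: "h 1 = h1" "h 2 = h2" "h 3 = h3" "h 4 = h4"
    by (simp_all add: h_def)
  have "?growth h"
    unfolding range using h1(1,2) h2(1,2) h3(1,2) h4(1,2) by (simp add: h_simps[simplified])
  moreover have "?rep h"
  proof
    fix f :: "real ^ 'n \<Rightarrow> complex"
    assume f: "f \<in> lp_fun p"
    have Re: "(\<lambda>x. Re (f x)) \<in> lp_space p" and Im: "(\<lambda>x. Im (f x)) \<in> lp_space p"
      using lp_fun_component[OF p f] by auto
    have int: "integrable lebesgue (\<lambda>x. k (u x))"
      if "continuous_on UNIV k" "\<exists>\<gamma>\<ge>0. \<forall>a. \<bar>k a\<bar> \<le> \<gamma> * \<bar>a\<bar> powr p" "u \<in> lp_space p"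
      for k :: "real \<Rightarrow> real" and u :: "real ^ 'n \<Rightarrow> real"
      using integrable_powr_growth that by metis
    have "Re (\<Phi> (lp_class p f)) = (LINT x|lebesgue. h1 (Re (f x)) + h3 (Im (f x)))"
      using lp_valuation_split[OF p \<Phi>(3) f] h1(3)[OF Re] h3(3)[OF Im]
        int[OF h1(1,2) Re] int[OF h3(1,2) Im] by simp
    moreover have "Im (\<Phi> (lp_class p f)) = (LINT x|lebesgue. h2 (Re (f x)) + h4 (Im (f x)))"
      using lp_valuation_split[OF p \<Phi>(3) f] h2(3)[OF Re] h4(3)[OF Im]
        int[OF h2(1,2) Re] int[OF h4(1,2) Im] by simp
    ultimately show "\<Phi> (lp_class p f) =
        complex_of_real (LINT x|lebesgue. h 1 (Re (f x)) + h 3 (Im (f x))) +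
        \<i> * complex_of_real (LINT x|lebesgue. h 2 (Re (f x)) + h 4 (Im (f x)))"
      unfolding h_simps by (simp add: complex_eq_iff)
  qed
  ultimately show "\<exists>h. ?growth h \<and> ?rep h"
    by blast
next
  assume "\<exists>h. ?growth h \<and> ?rep h"
  then obtain h where h: "?growth h" and rep: "?rep h"
    by blast
  have p: "p > 0"
    using assms by simp
  have pair: "\<exists>\<gamma> \<delta>. powr_growth_pair p (h j) (h k) \<gamma> \<delta>" if "j \<in> {1..4}" "k \<in> {1..4}" for j k
    using h that p unfolding powr_growth_pair_def by metis
  obtain \<gamma> \<delta> where "powr_growth_pair p (h 1) (h 3) \<gamma> \<delta>"
    using pair[of 1 3] by auto
  then interpret R: powr_growth_pair p "h 1" "h 3" \<gamma> \<delta> .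
  obtain \<gamma>' \<delta>' where "powr_growth_pair p (h 2) (h 4) \<gamma>' \<delta>'"
    using pair[of 2 4] by auto
  then interpret I: powr_growth_pair p "h 2" "h 4" \<gamma>' \<delta>' .
  \<comment> \<open>From here on continuity, invariance and the valuation identity are inherited
    from the two real functionals.\<close>
  have \<Phi>: "\<Phi> (lp_class p f) = complex_of_real (R.J f) + \<i> * complex_of_real (I.J f)"
    if "f \<in> lp_fun p" for f
    using rep that unfolding R.J_def I.J_def by blast
  have zero: "(\<lambda>_ :: real ^ 'n. 0) \<in> lp_fun p"
    by (simp add: lp_fun_eq_lp_space)
  have "lp_continuous p \<Phi>"
    unfolding lp_continuous_def
  proof (intro allI impI, elim conjE)
    fix F and f :: "real ^ 'n \<Rightarrow> complex"
    assume F: "\<forall>i. F i \<in> lp_fun p" and f: "f \<in> lp_fun p"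
      and lim: "(\<lambda>i. lp_norm p (\<lambda>x. F i x - f x)) \<longlonglongrightarrow> 0"
    show "(\<lambda>i. \<Phi> (lp_class p (F i))) \<longlonglongrightarrow> \<Phi> (lp_class p f)"
      unfolding \<Phi>[OF F[rule_format]] \<Phi>[OF f]
      by (intro tendsto_intros R.J_continuous I.J_continuous F[rule_format] f lim)
  qed
  moreover have "lp_translation_invariant p \<Phi>"
    unfolding lp_translation_invariant_def
  proof (intro ballI allI)
    fix f :: "real ^ 'n \<Rightarrow> complex" and t
    assume f: "f \<in> lp_fun p"
    then have "(\<lambda>x. f (x - t)) \<in> lp_fun p"
      unfolding lp_fun_eq_lp_space by (rule lp_space_translation)
    then show "\<Phi> (lp_class p (\<lambda>x. f (x - t))) = \<Phi> (lp_class p f)"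
      using f by (simp only: \<Phi> R.J_translation I.J_translation)
  qed
  moreover have "lp_valuation p \<Phi>"
    unfolding lp_valuation_def
  proof (intro conjI ballI)
    fix f k :: "real ^ 'n \<Rightarrow> complex"
    assume f: "f \<in> lp_fun p" and k: "k \<in> lp_fun p"
    note jm = lp_fun_join_meet[OF p f k]
    show "\<Phi> (lp_class p (fun_join f k)) + \<Phi> (lp_class p (fun_meet f k))
        = \<Phi> (lp_class p f) + \<Phi> (lp_class p k)"
      using R.J_valuation[OF f k jm] I.J_valuation[OF f k jm]
      by (simp add: \<Phi> f k jm complex_eq_iff)
  qed (simp only: \<Phi>[OF zero] R.J_zero I.J_zero of_real_0 mult_zero_right add_0_right)
  ultimately show ?lhs
    by blast
qed

end
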